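(* Let $G$ be a topological group containing subgroups $N,C\leq G$ that commute with each other (i.e. $nc=cn$ for all $n\in N$, $c\in C$). Let $\mu$ be a Baire probability measure on $C$, let $(V,\rho)$ be a uniformly bounded, strongly operator continuous, weakly uniquely $\mu$-stationary Banach $G$-module, and let $b\in Z^{n}(G,\rho)$ be an $n$-cocycle. Then $\widetilde{\mathbb{E}}_{\mu}\circ(b|_{N^{n+1}})$ defines an $n$-cocycle in $Z^{n}(N,\rho|_{N})$ that is almost cohomologous to the restriction $b|_{N^{n+1}}$.
   Context: Banach spaces are real or complex; topological groups are not assumed Hausdorff; $\mathbb{N}=\{0,1,2,\dots\}$. The Baire $\sigma$-algebra of a topological space $X$ is the smallest $\sigma$-algebra for which all continuous functions $X\to\mathbb{R}$ are measurable; a Baire probability measure on $X$ is a probability measure on it, and $\mathcal{P}_\sigma(X)$ is the set of these. Subgroups carry the subspace topology. A uniformly bounded Banach $G$-module $(V,\rho)$ is a Banach space $V$ with a group homomorphism $\rho:G\to \mathrm{GL}(V)$, $g\mapsto\rho_g$, into the invertible bounded operators such that $\sup_{g}\Vert\rho_g\Vert<\infty$. It is strongly (resp. weakly) operator continuous if for every $v\in V$ the map $g\mapsto\rho_g(v)$ is continuous for the norm (resp. weak) topology on $V$. For $\mu\in\mathcal{P}_\sigma(G)$, $(V,\rho)$ is $\mu$-integrable if it is weakly operator continuous and for every $v\in V$ there is $\rho_\mu(v)\in V$ with $\phi(\rho_\mu(v))=\int_G\phi(\rho_g(v))\,d\mu(g)$ for all $\phi\in V^*$; $\rho_\mu\in\mathcal{B}(V)$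 is the Markov operator, and $V^\mu:=\{v\in V\mid\rho_\mu(v)=v\}$. $(V,\rho)$ is weakly uniquely $\mu$-stationary if it is uniformly bounded, $\mu$-integrable, and for every non-zero $\phi\in V^*$ with $\phi\circ\rho_\mu=\phi$ there is $v\in V^\mu$ with $\phi(v)\neq0$. In that case $\widetilde{\mathbb{E}}_\mu\in\mathcal{B}(V)$ denotes the projection onto $V^\mu$ given by the (existing) norm limit $\widetilde{\mathbb{E}}_\mu(v)=\lim_{n\to\infty}\frac1n\sum_{i=0}^{n-1}\rho_\mu^i(v)$. If $\mu$ is a measure on a subgroup $C\le G$, these notions refer to the restriction $\rho|_C$. For a uniformly bounded strongly operator continuous Banach $G$-module $(V,\rho)$ and $n\in\mathbb{N}$, $C^n(G,V)$ is the space of continuous functions $G^n\to V$ (norm topology on $V$) with the compact-open topology, and $C^n(G,V)^G$ is the subspace of $f$ with $f(gg_1,\dots,gg_n)=\rho_g(f(g_1,\dots,g_n))$. Define $\partial^n:C^n(G,V)^G\to C^{n+1}(G,V)^G$ by $(\partial^nf)(g_1,\dots,g_{n+1})=\sum_{i=1}^{n+1}(-1)^{i+1}f(g_1,\dots,\widehat{g}_i,\dots,g_{n+1})$. Set $Z^n(G,\rho):=\ker(\partial^{n+1})\subseteq C^{n+1}(G,V)^G$ and $B^n(G,\rho):=\mathrm{im}(\partial^n)\subseteq C^{n+1}(G,V)^G$. Two $n$-cocycles are almost cohomologous if their difference lies in the closure $\overline{B^n}$ with respect to the compact-open topology (here $\overline{B^n(N,\rho|_N)}$). *)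

theory Defs
  imports "HOL-Probability.Probability" "HOL-Algebra.Coset"
begin

text \<open>Topological groups are abstract groups with a topology on the carrier; no separation axiom
  is assumed. A subgroup \<open>H\<close> is handled as the group \<open>G\<lparr>carrier := H\<rparr>\<close> with the topology
  \<open>subtopology T H\<close>.\<close>

locale topological_group = group G for G (structure) and T :: "'g topology" +
  assumes topspace_eq: "topspace T = carrier G"
    and continuous_mult: "continuous_map (prod_topology T T) T (\<lambda>(x, y). x \<otimes> y)"
    and continuous_inv: "continuous_map T T (\<lambda>x. inv x)"

definition baire_algebra :: "'a topology \<Rightarrow> 'a set set" where
  "baire_algebra X = sigma_sets (topspace X)
     {f -` A \<inter> topspace X | f A. continuous_map X euclideanreal f \<and> A \<in> sets borel}"

definition baire_prob_measures :: "'a topology \<Rightarrow> 'a measure set" where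
  "baire_prob_measures X = {\<mu>. prob_space \<mu> \<and> space \<mu> = topspace X \<and> sets \<mu> = baire_algebra X}"


text \<open>Real and complex Banach spaces are treated uniformly. By Frobenius' theorem, a commutative
  field that is a finite-dimensional real algebra is \<open>\<real>\<close> or \<open>\<complex>\<close>, so up to isometric isomorphism the
  types \<open>'k :: {real_normed_field, euclidean_space}\<close> are exactly \<^typ>\<open>real\<close> and \<^typ>\<open>complex\<close>. The
  type class \<^class>\<open>banach\<close> supplies the underlying complete real normed space, and \<open>smul\<close> is the
  multiplication by scalars from \<open>'k\<close> that extends the one by real scalars.\<close>

locale banach_space_over = vector_space smul
  for smul :: "'k :: {real_normed_field, euclidean_space} \<Rightarrow> 'v :: banach \<Rightarrow> 'v" +
  assumes scale_of_real: "smul (of_real r) v = r *\<^sub>R v"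
    and norm_scale: "norm (smul c v) = norm c * norm v"

definition bounded_operators :: "('k \<Rightarrow> 'v \<Rightarrow> 'v :: real_normed_vector) \<Rightarrow> ('v \<Rightarrow> 'v) set" where
  "bounded_operators smul =
     {A. bounded_linear A \<and> (\<forall>c v. A (smul c v) = smul c (A v))}"

definition dual_space ::
  "('k :: real_normed_field \<Rightarrow> 'v \<Rightarrow> 'v :: real_normed_vector) \<Rightarrow> ('v \<Rightarrow> 'k) set" where
  "dual_space smul = {\<phi>. bounded_linear \<phi> \<and> (\<forall>c v. \<phi> (smul c v) = c * \<phi> v)}"

definition weak_topology ::
  "('k :: real_normed_field \<Rightarrow> 'v \<Rightarrow> 'v :: real_normed_vector) \<Rightarrow> 'v topology" where
  "weak_topology smul = topology_generated_by {\<phi> -` U | \<phi> U. \<phi> \<in> dual_space smul \<and> open U}"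

definition GL :: "('k \<Rightarrow> 'v \<Rightarrow> 'v :: real_normed_vector) \<Rightarrow> ('v \<Rightarrow> 'v) monoid" where
  "GL smul =
     \<lparr>carrier = {A \<in> bounded_operators smul.
                  \<exists>B \<in> bounded_operators smul. A \<circ> B = id \<and> B \<circ> A = id},
      mult = (\<circ>), one = id\<rparr>"

definition uniformly_bounded_module ::
  "('g, 'm) monoid_scheme \<Rightarrow> ('k :: {real_normed_field, euclidean_space} \<Rightarrow> 'v :: banach \<Rightarrow> 'v)
     \<Rightarrow> ('g \<Rightarrow> 'v \<Rightarrow> 'v) \<Rightarrow> bool" where
  "uniformly_bounded_module G smul \<rho> \<longleftrightarrow>
     banach_space_over smul \<and> \<rho> \<in> hom G (GL smul) \<and>
     bdd_above ((\<lambda>g. onorm (\<rho> g)) ` carrier G)"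

definition strongly_operator_continuous ::
  "'g topology \<Rightarrow> ('g \<Rightarrow> 'v \<Rightarrow> 'v :: real_normed_vector) \<Rightarrow> bool" where
  "strongly_operator_continuous T \<rho> \<longleftrightarrow> (\<forall>v. continuous_map T euclidean (\<lambda>g. \<rho> g v))"

definition weakly_operator_continuous ::
  "'g topology \<Rightarrow> ('k :: real_normed_field \<Rightarrow> 'v \<Rightarrow> 'v :: real_normed_vector)
     \<Rightarrow> ('g \<Rightarrow> 'v \<Rightarrow> 'v) \<Rightarrow> bool" where
  "weakly_operator_continuous T smul \<rho> \<longleftrightarrow>
     (\<forall>v. continuous_map T (weak_topology smul) (\<lambda>g. \<rho> g v))"


definition is_markov_value ::
  "'g measure \<Rightarrow> ('k :: {real_normed_field, euclidean_space} \<Rightarrow> 'v \<Rightarrow> 'v :: real_normed_vector)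
     \<Rightarrow> ('g \<Rightarrow> 'v \<Rightarrow> 'v) \<Rightarrow> 'v \<Rightarrow> 'v \<Rightarrow> bool" where
  "is_markov_value \<mu> smul \<rho> v w \<longleftrightarrow>
     (\<forall>\<phi> \<in> dual_space smul. \<phi> w = (\<integral>g. \<phi> (\<rho> g v) \<partial>\<mu>))"

definition mu_integrable ::
  "'g topology \<Rightarrow> 'g measure
     \<Rightarrow> ('k :: {real_normed_field, euclidean_space} \<Rightarrow> 'v \<Rightarrow> 'v :: real_normed_vector)
     \<Rightarrow> ('g \<Rightarrow> 'v \<Rightarrow> 'v) \<Rightarrow> bool" where
  "mu_integrable T \<mu> smul \<rho> \<longleftrightarrow>
     weakly_operator_continuous T smul \<rho> \<and> (\<forall>v. \<exists>w. is_markov_value \<mu> smul \<rho> v w)"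

text \<open>The value below is unique when it exists, since the dual space separates points.\<close>

definition markov_operator ::
  "'g measure \<Rightarrow> ('k :: {real_normed_field, euclidean_space} \<Rightarrow> 'v \<Rightarrow> 'v :: real_normed_vector)
     \<Rightarrow> ('g \<Rightarrow> 'v \<Rightarrow> 'v) \<Rightarrow> 'v \<Rightarrow> 'v" where
  "markov_operator \<mu> smul \<rho> v = (THE w. is_markov_value \<mu> smul \<rho> v w)"

definition stationary_vectors ::
  "'g measure \<Rightarrow> ('k :: {real_normed_field, euclidean_space} \<Rightarrow> 'v \<Rightarrow> 'v :: real_normed_vector)
     \<Rightarrow> ('g \<Rightarrow> 'v \<Rightarrow> 'v) \<Rightarrow> 'v set" where
  "stationary_vectors \<mu> smul \<rho> = {v. markov_operator \<mu> smul \<rho> v = v}"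

definition weakly_uniquely_stationary ::
  "('g, 'm) monoid_scheme \<Rightarrow> 'g topology \<Rightarrow> 'g measure
     \<Rightarrow> ('k :: {real_normed_field, euclidean_space} \<Rightarrow> 'v :: banach \<Rightarrow> 'v)
     \<Rightarrow> ('g \<Rightarrow> 'v \<Rightarrow> 'v) \<Rightarrow> bool" where
  "weakly_uniquely_stationary G T \<mu> smul \<rho> \<longleftrightarrow>
     uniformly_bounded_module G smul \<rho> \<and> mu_integrable T \<mu> smul \<rho> \<and>
     (\<forall>\<phi> \<in> dual_space smul. \<phi> \<noteq> (\<lambda>v. 0) \<longrightarrow> \<phi> \<circ> markov_operator \<mu> smul \<rho> = \<phi> \<longrightarrow>
        (\<exists>v \<in> stationary_vectors \<mu> smul \<rho>. \<phi> v \<noteq> 0))"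

definition mean_projection ::
  "'g measure \<Rightarrow> ('k :: {real_normed_field, euclidean_space} \<Rightarrow> 'v \<Rightarrow> 'v :: real_normed_vector)
     \<Rightarrow> ('g \<Rightarrow> 'v \<Rightarrow> 'v) \<Rightarrow> 'v \<Rightarrow> 'v" where
  "mean_projection \<mu> smul \<rho> v =
     lim (\<lambda>n. (1 / real n) *\<^sub>R (\<Sum>i<n. (markov_operator \<mu> smul \<rho> ^^ i) v))"


definition continuous_maps :: "'a topology \<Rightarrow> 'b topology \<Rightarrow> ('a \<Rightarrow> 'b) set" where
  "continuous_maps X Y = {f \<in> extensional (topspace X). continuous_map X Y f}"

definition compact_open_topology :: "'a topology \<Rightarrow> 'b topology \<Rightarrow> ('a \<Rightarrow> 'b) topology" where
  "compact_open_topology X Y = topology_generated_by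
     {{f \<in> continuous_maps X Y. f ` K \<subseteq> U} | K U. compactin X K \<and> openin Y U}"

text \<open>Points of \<open>G\<^sup>n\<close> are extensional functions on \<open>{..<n}\<close>; entries are indexed from \<open>0\<close>, so the
  sign of the \<open>i\<close>-th face in the coboundary is \<open>(- 1) ^ i\<close>.\<close>

abbreviation power_topology :: "'a topology \<Rightarrow> nat \<Rightarrow> (nat \<Rightarrow> 'a) topology" where
  "power_topology T n \<equiv> product_topology (\<lambda>_. T) {..<n}"

definition cochains :: "'g topology \<Rightarrow> nat \<Rightarrow> ((nat \<Rightarrow> 'g) \<Rightarrow> 'v :: real_normed_vector) set" where
  "cochains T n = continuous_maps (power_topology T n) euclidean"

definition invariant_cochains ::
  "('g, 'm) monoid_scheme \<Rightarrow> 'g topology \<Rightarrow> ('g \<Rightarrow> 'v \<Rightarrow> 'v :: real_normed_vector) \<Rightarrow> nat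
     \<Rightarrow> ((nat \<Rightarrow> 'g) \<Rightarrow> 'v) set" where
  "invariant_cochains G T \<rho> n =
     {f \<in> cochains T n. \<forall>g \<in> carrier G. \<forall>x \<in> topspace (power_topology T n).
        f (\<lambda>i\<in>{..<n}. g \<otimes>\<^bsub>G\<^esub> x i) = \<rho> g (f x)}"

definition omit :: "nat \<Rightarrow> nat \<Rightarrow> (nat \<Rightarrow> 'a) \<Rightarrow> nat \<Rightarrow> 'a" where
  "omit n i x = (\<lambda>j\<in>{..<n}. if j < i then x j else x (Suc j))"

definition coboundary ::
  "'g topology \<Rightarrow> nat \<Rightarrow> ((nat \<Rightarrow> 'g) \<Rightarrow> 'v :: real_normed_vector) \<Rightarrow> (nat \<Rightarrow> 'g) \<Rightarrow> 'v" where
  "coboundary T n f =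
     (\<lambda>x\<in>topspace (power_topology T (n + 1)). \<Sum>i<n + 1. (- 1) ^ i *\<^sub>R f (omit n i x))"

definition cocycles ::
  "('g, 'm) monoid_scheme \<Rightarrow> 'g topology \<Rightarrow> ('g \<Rightarrow> 'v \<Rightarrow> 'v :: real_normed_vector) \<Rightarrow> nat
     \<Rightarrow> ((nat \<Rightarrow> 'g) \<Rightarrow> 'v) set" where
  "cocycles G T \<rho> n =
     {f \<in> invariant_cochains G T \<rho> (n + 1).
        \<forall>x \<in> topspace (power_topology T (n + 2)). coboundary T (n + 1) f x = 0}"

definition coboundaries ::
  "('g, 'm) monoid_scheme \<Rightarrow> 'g topology \<Rightarrow> ('g \<Rightarrow> 'v \<Rightarrow> 'v :: real_normed_vector) \<Rightarrow> nat
     \<Rightarrow> ((nat \<Rightarrow> 'g) \<Rightarrow> 'v) set" where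
  "coboundaries G T \<rho> n = coboundary T n ` invariant_cochains G T \<rho> n"

definition almost_cohomologous ::
  "('g, 'm) monoid_scheme \<Rightarrow> 'g topology \<Rightarrow> ('g \<Rightarrow> 'v \<Rightarrow> 'v :: real_normed_vector) \<Rightarrow> nat
     \<Rightarrow> ((nat \<Rightarrow> 'g) \<Rightarrow> 'v) \<Rightarrow> ((nat \<Rightarrow> 'g) \<Rightarrow> 'v) \<Rightarrow> bool" where
  "almost_cohomologous G T \<rho> n f h \<longleftrightarrow>
     f \<in> cocycles G T \<rho> n \<and> h \<in> cocycles G T \<rho> n \<and>
     (\<lambda>x\<in>topspace (power_topology T (n + 1)). f x - h x)
       \<in> (subtopology (compact_open_topology (power_topology T (n + 1)) euclidean)
            (invariant_cochains G T \<rho> (n + 1))) closure_of (coboundaries G T \<rho> n)"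

end

theory Submission
  imports Defs
begin

text \<open>Right translation by \<open>c \<in> C\<close> is chain homotopic to the identity, and on \<open>N\<close> it agrees with left
  translation, so \<open>\<rho> c \<circ> b - b\<close> is a coboundary on \<open>N\<close> for every \<open>c \<in> C\<close>. The homotopy need not be
  bounded in \<open>c\<close>, so it cannot be integrated against \<open>\<mu>\<close>; instead one uses convex combinations.
  By the Hahn-Banach theorem, weak unique stationarity makes the sum of the fixed vectors and the
  range of \<open>id - P\<close> dense, where \<open>P\<close> is the Markov operator, so the ergodic averages of \<open>P\<close> converge
  to a projection \<open>E\<close>. A further separation argument, applied to tuples of vectors, shows that \<open>E\<close> lies
  in the closure of the convex hull of the operators \<open>\<rho> c\<close> in the strong operator topology. All these
  operators are uniformly bounded, so the approximation is uniform on the compact sets \<open>b ` K\<close>, which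
  makes \<open>E \<circ> b - b\<close> a limit of coboundaries in the compact-open topology.\<close>

section \<open>Hahn-Banach separation\<close>

definition sublinear :: "('a::real_vector \<Rightarrow> real) \<Rightarrow> bool" where
  "sublinear p \<longleftrightarrow>
     (\<forall>x y. p (x + y) \<le> p x + p y) \<and> (\<forall>a x. 0 \<le> a \<longrightarrow> p (a *\<^sub>R x) = a * p x)"

lemma sublinear_add: "sublinear p \<Longrightarrow> p (x + y) \<le> p x + p y"
  and sublinear_scaleR: "sublinear p \<Longrightarrow> 0 \<le> a \<Longrightarrow> p (a *\<^sub>R x) = a * p x"
  by (auto simp: sublinear_def)

lemma sublinear_zero: "sublinear p \<Longrightarrow> p 0 = 0"
  using sublinear_scaleR[of p 0 0] by simp

lemma sublinear_minus: "sublinear p \<Longrightarrow> - p (- x) \<le> p x"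
  using sublinear_add[of p x "- x"] sublinear_zero[of p] by simp

text \<open>Applying the scaling inequality with \<open>1/a\<close> gives its converse, and the
  factors \<open>2\<close> and \<open>1/2\<close> force \<open>p 0 = 0\<close>.\<close>

lemma sublinearI:
  assumes add: "\<And>x y. p (x + y) \<le> p x + p y"
    and scale: "\<And>a x. 0 < a \<Longrightarrow> p (a *\<^sub>R x) \<le> a * p x"
  shows "sublinear p"
  unfolding sublinear_def
proof (intro conjI allI impI add)
  fix a :: real and x
  assume "0 \<le> a"
  have "p 0 = 0"
    using scale[of 2 0] scale[of "1/2" 0] by simp
  moreover have "p (a *\<^sub>R x) = a * p x" if "0 < a"
    using scale[of a x] scale[of "1/a" "a *\<^sub>R x"] that by (simp add: field_simps)
  ultimately show "p (a *\<^sub>R x) = a * p x"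
    using \<open>0 \<le> a\<close> by (cases "a = 0") auto
qed

lemma sublinear_norm: "sublinear (norm :: 'a::real_normed_vector \<Rightarrow> real)"
  by (auto simp: sublinear_def norm_triangle_ineq)

text \<open>With \<open>S = {y}\<close> and \<open>\<alpha> = p y\<close> this shows that minimal sublinear functionals are odd, hence
  linear; with \<open>p = norm\<close> it gives the separation of a convex set from the origin.\<close>

lemma sublinear_decrease:
  fixes p :: "'a::real_vector \<Rightarrow> real"
  assumes p: "sublinear p" and "convex S" and "S \<noteq> {}" and S: "\<And>s. s \<in> S \<Longrightarrow> \<alpha> \<le> p s"
  obtains q where "sublinear q" "\<And>x. q x \<le> p x" "\<And>s. s \<in> S \<Longrightarrow> q (- s) \<le> - \<alpha>"
proof
  \<comment> \<open>\<open>q\<close> is the largest sublinear functional below \<open>p\<close> with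
    \<open>q (- s) \<le> - \<alpha>\<close> on \<open>S\<close>: any such \<open>r\<close> satisfies
    \<open>r x \<le> r (x + t *\<^sub>R s) + t * r (- s) \<le> F x (t, s)\<close>.\<close>
  define I where "I = {0::real..} \<times> S"
  define F where "F = (\<lambda>x (t, s). p (x + t *\<^sub>R s) - t * \<alpha>)"
  define q where "q = (\<lambda>x. INF i\<in>I. F x i)"
  have I: "I \<noteq> {}" using \<open>S \<noteq> {}\<close> by (auto simp: I_def)
  \<comment> \<open>The bound \<alpha> \<le> p on \<open>S\<close> enters here; it keeps the infimum
    finite.\<close>
  have lower: "- p (- x) \<le> F x i" if iI: "i \<in> I" for x i
  proof -
    obtain t s where i: "i = (t, s)" "0 \<le> t" "s \<in> S" using iI by (auto simp: I_def)
    have "t * \<alpha> \<le> t * p s" using i S by (simp add: mult_left_mono)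
    also have "\<dots> = p (t *\<^sub>R s)" using p i by (simp add: sublinear_scaleR)
    also have "\<dots> \<le> p (- x) + p (x + t *\<^sub>R s)"
      using sublinear_add[OF p, of "- x" "x + t *\<^sub>R s"] by simp
    finally show ?thesis by (simp add: F_def i)
  qed
  have bdd: "bdd_below (F x ` I)" for x
    using lower by (auto intro!: bdd_belowI2)
  have le: "q x \<le> F x i" if "i \<in> I" for x i
    unfolding q_def using bdd that by (rule cINF_lower)
  obtain s0 where s0: "s0 \<in> S" using \<open>S \<noteq> {}\<close> by blast
  show "q x \<le> p x" for x
    using le[of "(0, s0)" x] s0 by (simp add: I_def F_def)
  show "q (- s) \<le> - \<alpha>" if "s \<in> S" for s
    using le[of "(1, s)" "- s"] that p by (simp add: I_def F_def sublinear_zero)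
  show "sublinear q"
  proof (rule sublinearI)
    fix x y
    have *: "q (x + y) \<le> F x i + F y j" if ij: "i \<in> I" "j \<in> I" for i j
    proof -
      obtain t s where i: "i = (t, s)" "0 \<le> t" "s \<in> S" using ij by (auto simp: I_def)
      obtain t' s' where j: "j = (t', s')" "0 \<le> t'" "s' \<in> S" using ij by (auto simp: I_def)
      \<comment> \<open>Convexity merges the two shifts into one shift by a single element of
        \<open>S\<close>, with parameter \<open>t + t'\<close>.\<close>
      obtain r where r: "r \<in> S" "(t + t') *\<^sub>R r = t *\<^sub>R s + t' *\<^sub>R s'"
      proof (cases "t + t' = 0")
        case True
        then have "t = 0" "t' = 0" using i j by auto
        then show ?thesis using that i by auto
      next
        case False
        then have "t + t' > 0" using i j by auto
        then have "(t / (t + t')) *\<^sub>R s + (t' / (t + t')) *\<^sub>R s' \<in> S"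
          using i j by (intro convexD[OF \<open>convex S\<close>]) (auto simp flip: add_divide_distrib)
        then show ?thesis
          using False by (intro that) (auto simp: scaleR_add_right)
      qed
      have "q (x + y) \<le> F (x + y) (t + t', r)"
        using i j r by (intro le) (auto simp: I_def)
      also have "\<dots> = p ((x + t *\<^sub>R s) + (y + t' *\<^sub>R s')) - t * \<alpha> - t' * \<alpha>"
        using r(2) by (simp add: F_def algebra_simps)
      also have "\<dots> \<le> F x i + F y j"
        using sublinear_add[OF p, of "x + t *\<^sub>R s" "y + t' *\<^sub>R s'"] by (simp add: F_def i j)
      finally show ?thesis .
    qed
    have "q (x + y) - F y j \<le> q x" if "j \<in> I" for j
      unfolding q_def[THEN fun_cong, of x]
      using * that I by (intro cINF_greatest) (auto simp: algebra_simps)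
    then have "q (x + y) - q x \<le> q y"
      unfolding q_def[THEN fun_cong, of y] using I
      by (intro cINF_greatest) (auto simp: algebra_simps)
    then show "q (x + y) \<le> q x + q y" by simp
  next
    fix a :: real and x
    assume a: "0 < a"
    have "q (a *\<^sub>R x) / a \<le> F x i" if iI: "i \<in> I" for i
    proof -
      obtain t s where i: "i = (t, s)" "0 \<le> t" "s \<in> S" using iI by (auto simp: I_def)
      have "q (a *\<^sub>R x) \<le> F (a *\<^sub>R x) (a * t, s)"
        using i a by (intro le) (auto simp: I_def)
      also have "\<dots> = p (a *\<^sub>R (x + t *\<^sub>R s)) - a * t * \<alpha>"
        by (simp add: F_def scaleR_add_right)
      also have "\<dots> = a * F x i"
        using a p by (simp add: F_def i sublinear_scaleR right_diff_distrib del: scaleR_add_right)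
      finally show ?thesis using a by (simp add: field_simps)
    qed
    then have "q (a *\<^sub>R x) / a \<le> q x"
      unfolding q_def[THEN fun_cong, of x] using I by (intro cINF_greatest) auto
    then show "q (a *\<^sub>R x) \<le> a * q x" using a by (simp add: field_simps)
  qed
qed

text \<open>The pointwise infimum is finite because every member is at least
  \<open>- p (- x)\<close>. It is subadditive because, of two members of a chain, the smaller can
  serve for both summands. This gives the chain bounds for Zorn's lemma.\<close>

lemma sublinear_chain_inf:
  fixes K :: "('a::real_vector \<Rightarrow> real) set"
  assumes K: "K \<noteq> {}" "\<And>q. q \<in> K \<Longrightarrow> sublinear q" "\<And>q x. q \<in> K \<Longrightarrow> q x \<le> p x"
    and chain: "\<And>q r. q \<in> K \<Longrightarrow> r \<in> K \<Longrightarrow> q \<le> r \<or> r \<le> q"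
  obtains l where "sublinear l" "\<And>q. q \<in> K \<Longrightarrow> l \<le> q"
proof
  define l where "l = (\<lambda>x. INF q\<in>K. q x)"
  have "- p (- x) \<le> q x" if "q \<in> K" for q x
    using sublinear_minus[OF K(2)[OF that], of x] K(3)[OF that, of "- x"] by simp
  then have bdd: "bdd_below ((\<lambda>q. q x) ` K)" for x
    by (intro bdd_belowI2)
  have le: "l x \<le> q x" if "q \<in> K" for q x
    unfolding l_def using bdd that by (rule cINF_lower)
  then show "l \<le> q" if "q \<in> K" for q
    using that by (auto intro: le_funI)
  show "sublinear l"
  proof (rule sublinearI)
    fix x y
    have *: "l (x + y) \<le> q x + r y" if "q \<in> K" "r \<in> K" for q r
      using chain[OF that] le[OF that(1), of "x + y"] le[OF that(2), of "x + y"]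
        sublinear_add[OF K(2)[OF that(1)], of x y] sublinear_add[OF K(2)[OF that(2)], of x y]
      by (smt (verit) le_funD)
    have "l (x + y) - r y \<le> l x" if "r \<in> K" for r
      unfolding l_def[THEN fun_cong, of x]
      using * that K by (intro cINF_greatest) (auto simp: algebra_simps)
    then have "l (x + y) - l x \<le> l y"
      unfolding l_def[THEN fun_cong, of y] using K(1)
      by (intro cINF_greatest) (auto simp: algebra_simps)
    then show "l (x + y) \<le> l x + l y" by simp
  next
    fix a :: real and x
    assume a: "0 < a"
    have "l (a *\<^sub>R x) / a \<le> q x" if "q \<in> K" for q
      using le[OF that, of "a *\<^sub>R x"] K(2)[OF that] a by (simp add: sublinear_scaleR field_simps)
    then have "l (a *\<^sub>R x) / a \<le> l x"
      unfolding l_def[THEN fun_cong, of x] using K(1) by (intro cINF_greatest) auto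
    then show "l (a *\<^sub>R x) \<le> a * l x" using a by (simp add: field_simps)
  qed
qed

theorem hahn_banach_sublinear:
  fixes p :: "'a::real_vector \<Rightarrow> real"
  assumes p: "sublinear p"
  obtains f where "linear f" "\<And>x. f x \<le> p x"
proof -
  define A where "A = {q. sublinear q \<and> q \<le> p}"
  \<comment> \<open>Zorn's lemma is applied to the reversed order, so the maximal element is a
    minimal sublinear functional below \<open>p\<close>.\<close>
  have "\<exists>m\<in>A. \<forall>a\<in>A. m \<ge> a \<longrightarrow> a = m"
  proof (rule predicate_Zorn)
    show "partial_order_on A (relation_of (\<lambda>x y. x \<ge> y) A)"
      by (auto simp: relation_of_def partial_order_on_def preorder_on_def refl_on_def
          intro!: transI antisymI)
  next
    fix K
    assume "K \<in> Chains (relation_of (\<lambda>x y. x \<ge> y) A)"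
    then have K: "\<And>q. q \<in> K \<Longrightarrow> q \<in> A" "\<And>q r. q \<in> K \<Longrightarrow> r \<in> K \<Longrightarrow> q \<le> r \<or> r \<le> q"
      by (auto simp: Chains_def relation_of_def)
    show "\<exists>u\<in>A. \<forall>a\<in>K. u \<le> a"
    proof (cases "K = {}")
      case True
      then show ?thesis using p by (auto simp: A_def)
    next
      case False
      have "sublinear q" "q x \<le> p x" if "q \<in> K" for q x
        using K(1)[OF that] by (auto simp: A_def le_fun_def)
      then obtain l where l: "sublinear l" "\<And>q. q \<in> K \<Longrightarrow> l \<le> q"
        using sublinear_chain_inf[OF False _ _ K(2)] by metis
      moreover have "l \<le> p"
        using False K(1) l(2) by (force simp: A_def intro: order_trans)
      ultimately show ?thesis by (auto simp: A_def)
    qed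
  qed
  then obtain f where f: "sublinear f" "f \<le> p" and min: "\<And>q. q \<in> A \<Longrightarrow> q \<le> f \<Longrightarrow> q = f"
    by (auto simp: A_def)
  have odd: "f (- y) = - f y" for y
  proof -
    obtain q where q: "sublinear q" "\<And>x. q x \<le> f x" "q (- y) \<le> - f y"
      using sublinear_decrease[OF f(1), of "{y}" "f y"] by auto
    then have "q = f"
      using f(2) by (intro min) (auto simp: A_def le_fun_def intro: order_trans)
    then show ?thesis
      using q(3) sublinear_minus[OF f(1), of y] by simp
  qed
  have "linear f"
  proof (rule linearI)
    show "f (x + y) = f x + f y" for x y
      using sublinear_add[OF f(1), of x y] sublinear_add[OF f(1), of "- x" "- y"]
        odd[of "x + y"] odd[of x] odd[of y] by simp
    show "f (c *\<^sub>R x) = c *\<^sub>R f x" for c x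
      using sublinear_scaleR[OF f(1), of c x] sublinear_scaleR[OF f(1), of "- c" x]
        odd[of "c *\<^sub>R x"] by (cases "0 \<le> c") auto
  qed
  then show thesis using that f(2) by (auto simp: le_fun_def)
qed

text \<open>A linear \<open>f\<close> below the decreased functional \<open>q\<close> satisfies
  \<open>f s = - f (- s) \<ge> - q (- s) \<ge> \<epsilon>\<close>, while \<open>q \<le> norm\<close>
  bounds its norm by \<open>1\<close>.\<close>

theorem separate_zero_from_convex:
  fixes S :: "'a::real_normed_vector set"
  assumes "convex S" and "\<And>s. s \<in> S \<Longrightarrow> \<epsilon> \<le> norm s"
  obtains f :: "'a \<Rightarrow> real"
  where "bounded_linear f" "\<And>x. \<bar>f x\<bar> \<le> norm x" "\<And>s. s \<in> S \<Longrightarrow> \<epsilon> \<le> f s"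
proof (cases "S = {}")
  case True
  then show ?thesis using that[of "\<lambda>x. 0"] by simp
next
  case False
  obtain q where q: "sublinear q" "\<And>x. q x \<le> norm x" "\<And>s. s \<in> S \<Longrightarrow> q (- s) \<le> - \<epsilon>"
    using sublinear_decrease[OF sublinear_norm assms(1) False assms(2)] by blast
  obtain f where f: "linear f" "\<And>x. f x \<le> q x"
    using hahn_banach_sublinear[OF q(1)] by blast
  have "f x \<le> norm x" for x using f(2) q(2) by (rule order_trans)
  then have bd: "\<bar>f x\<bar> \<le> norm x" for x
    using linear_neg[OF f(1), of x] by (metis abs_le_iff norm_minus_cancel)
  show ?thesis
  proof
    show "bounded_linear f"
      using f(1) bd by (auto intro!: bounded_linear_intro[where K = 1]
          simp: linear_add linear_scale)
    show "\<epsilon> \<le> f s" if "s \<in> S" for s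
      using f(2)[of "- s"] q(3)[OF that] linear_neg[OF f(1), of s] by simp
  qed (use bd in auto)
qed

corollary norming_functional:
  fixes w :: "'a::real_normed_vector"
  obtains f :: "'a \<Rightarrow> real"
  where "bounded_linear f" "\<And>x. \<bar>f x\<bar> \<le> norm x" "f w = norm w"
proof -
  obtain f :: "'a \<Rightarrow> real"
    where "bounded_linear f" "\<And>x. \<bar>f x\<bar> \<le> norm x" "norm w \<le> f w"
    using separate_zero_from_convex[of "{w}" "norm w"] by auto
  then show thesis using that by (smt (verit))
qed

corollary eq_if_functionals_eq:
  fixes v w :: "'a::real_normed_vector"
  assumes "\<And>f :: 'a \<Rightarrow> real. bounded_linear f \<Longrightarrow> f v = f w"
  shows "v = w"
proof -
  obtain f :: "'a \<Rightarrow> real" where "bounded_linear f" "f (v - w) = norm (v - w)"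
    using norming_functional by metis
  then show ?thesis using assms[of f] by (simp add: bounded_linear.linear linear_diff)
qed

text \<open>Separating the translate of \<open>M\<close> by \<open>- z\<close> from the origin gives
  a functional that is bounded below on the subspace \<open>M\<close>, and such a functional
  vanishes there.\<close>

corollary annihilator_of_non_dense_subspace:
  fixes M :: "'a::real_normed_vector set"
  assumes "subspace M" and "z \<notin> closure M"
  obtains f :: "'a \<Rightarrow> real"
  where "bounded_linear f" "\<And>m. m \<in> M \<Longrightarrow> f m = 0" "f z \<noteq> 0"
proof -
  obtain \<epsilon> where \<epsilon>: "0 < \<epsilon>" "\<And>m. m \<in> M \<Longrightarrow> \<epsilon> \<le> dist m z"
    using assms(2) by (auto simp: closure_approachable not_less)
  have "convex ((\<lambda>m. m - z) ` M)"
    using assms(1) by (intro convex_translation_subtract subspace_imp_convex)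
  then obtain f :: "'a \<Rightarrow> real" where f: "bounded_linear f" "\<And>m. m \<in> M \<Longrightarrow> \<epsilon> \<le> f (m - z)"
    using separate_zero_from_convex[of "(\<lambda>m. m - z) ` M" \<epsilon>] \<epsilon>(2)
    by (metis (no_types, lifting) dist_norm image_iff)
  interpret f: bounded_linear f by fact
  have "f m = 0" if m: "m \<in> M" for m
  proof (rule ccontr)
    assume "f m \<noteq> 0"
    \<comment> \<open>The scalar is chosen so that \<open>f\<close> takes the value \<epsilon> - 1
      on the corresponding element of the translate, below the separation bound.\<close>
    have "(((\<epsilon> + f z - 1) / f m) *\<^sub>R m) \<in> M"
      using m assms(1) by (rule subspace_scale[rotated])
    from f(2)[OF this] show False using \<open>f m \<noteq> 0\<close> by (simp add: f.diff f.scaleR)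
  qed
  moreover have "f z \<noteq> 0"
    using f(2)[of 0] \<epsilon>(1) subspace_0[OF assms(1)] by (auto simp: f.neg f.zero)
  ultimately show thesis using that f(1) by blast
qed

section \<open>Markov operators and the mean ergodic theorem\<close>

lemma (in banach_space_over) smul_scaleR: "smul c (r *\<^sub>R v) = r *\<^sub>R smul c v"
  by (simp add: mult.commute flip: scale_of_real)

lemma (in banach_space_over) bounded_linear_smul: "bounded_linear (smul c)"
  by (rule bounded_linear_intro[where K = "norm c"])
    (simp_all add: scale_right_distrib smul_scaleR norm_scale mult.commute)

text \<open>Over \<open>\<complex>\<close> this is the correspondence between complex functionals and their real parts. In general,
  \<open>(a, c) \<mapsto> inner (a * c) 1\<close> is a nondegenerate bilinear form on the scalar field.\<close>

lemma real_functional_eq_inner_dual: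
  fixes smul :: "'k :: {real_normed_field, euclidean_space} \<Rightarrow> 'v :: banach \<Rightarrow> 'v" and f :: "'v \<Rightarrow> real"
  assumes smul: "banach_space_over smul" and f: "bounded_linear f"
  obtains \<phi> where "\<phi> \<in> dual_space smul" "\<And>c v. inner (c * \<phi> v) 1 = f (smul c v)"
proof -
  interpret banach_space_over smul by fact
  interpret f: bounded_linear f by fact
  have scaleR_smul: "smul (r *\<^sub>R c) v = r *\<^sub>R smul c v" for r c v
    by (simp add: scaleR_conv_of_real flip: scale_of_real)
  \<comment> \<open>\<open>T a\<close> is the vector representing the real functional
    \<open>b \<mapsto> inner (a * b) 1\<close>. Its inverse \<open>S\<close> recovers the scalar
    from the functional.\<close>
  define T :: "'k \<Rightarrow> 'k" where "T = (\<lambda>a. \<Sum>b\<in>Basis. inner (a * b) 1 *\<^sub>R b)"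
  have T_inner: "inner (T a) b = inner (a * b) 1" if "b \<in> Basis" for a b
    using that by (simp add: T_def inner_sum_left inner_Basis if_distrib cong: if_cong)
  have "linear T"
    by (rule linearI) (simp_all add: T_def algebra_simps sum.distrib scaleR_sum_right)
  have lin_right: "linear (\<lambda>c. inner (a * c) 1)" for a :: 'k
    by (rule linearI) (simp_all add: algebra_simps)
  have nondegenerate: "a = 0" if "\<And>c. inner (a * c) 1 = 0" for a :: 'k
  proof (rule ccontr)
    assume "a \<noteq> 0"
    then show False using that[of "inverse a"] by simp
  qed
  have "inj T"
    unfolding linear_injective_0[OF \<open>linear T\<close>]
  proof (intro allI impI nondegenerate)
    fix a c
    assume "T a = 0"
    then have "inner (a * b) 1 = 0" if "b \<in> Basis" for b
      using T_inner[OF that, of a] by simp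
    then have "(\<lambda>c. inner (a * c) 1) = (\<lambda>_. 0)"
      by (rule linear_eq_stdbasis[OF lin_right linear_zero])
    then show "inner (a * c) 1 = 0" by (rule fun_cong)
  qed
  then obtain S where S: "linear S" "\<And>x. T (S x) = x"
    using linear_injective_isomorphism[OF \<open>linear T\<close>] by blast
  \<comment> \<open>For each \<open>v\<close>, \<open>\<phi> v\<close> is the scalar whose pairing
    with every basis element \<open>b\<close> is \<open>f (smul b v)\<close>.\<close>
  define \<phi> where "\<phi> = (\<lambda>v. S (\<Sum>b\<in>Basis. f (smul b v) *\<^sub>R b))"
  have "bounded_linear S"
    using S(1) by (simp add: linear_conv_bounded_linear)
  moreover have "bounded_linear (\<lambda>v. \<Sum>b\<in>Basis. f (smul b v) *\<^sub>R b)"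
    by (intro bounded_linear_sum bounded_linear_compose[OF bounded_linear_scaleR_left]
        bounded_linear_compose[OF f bounded_linear_smul])
  ultimately have "bounded_linear \<phi>"
    unfolding \<phi>_def by (rule bounded_linear_compose)
  have basis: "inner (\<phi> v * b) 1 = f (smul b v)" if "b \<in> Basis" for b v
  proof -
    have "inner (\<phi> v * b) 1 = inner (T (\<phi> v)) b" using that by (simp add: T_inner)
    also have "\<dots> = f (smul b v)"
      using that by (simp add: \<phi>_def S(2) inner_sum_left inner_Basis if_distrib cong: if_cong)
    finally show ?thesis .
  qed
  have lin: "linear (\<lambda>c. f (smul c v))" for v
    by (rule linearI) (simp_all add: scale_left_distrib scaleR_smul f.add f.scaleR)
  have rep: "inner (c * \<phi> v) 1 = f (smul c v)" for c v
    using fun_cong[OF linear_eq_stdbasis[OF lin_right lin basis], of v c] by (simp add: mult.commute)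
  have "\<phi> (smul c v) = c * \<phi> v" for c v
  proof -
    have "inner ((\<phi> (smul c v) - c * \<phi> v) * d) 1 = 0" for d
    proof -
      have "inner ((\<phi> (smul c v) - c * \<phi> v) * d) 1
          = inner (d * \<phi> (smul c v)) 1 - inner ((d * c) * \<phi> v) 1"
        by (simp add: algebra_simps)
      then show ?thesis by (simp add: rep)
    qed
    from nondegenerate[OF this] show ?thesis by simp
  qed
  then show thesis
    using that[of \<phi>] \<open>bounded_linear \<phi>\<close> rep by (auto simp: dual_space_def)
qed

text \<open>Only the analytic content of the hypotheses is retained: \<open>C\<close> indexes a
  monoid of operators with the common bound \<open>M\<close>, and the topology enters through
  measurability of \<open>f (\<rho> g v)\<close>.\<close>

locale markov_module =
  fixes C :: "'g set" and \<mu> :: "'g measure"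
    and smul :: "'k :: {real_normed_field, euclidean_space} \<Rightarrow> 'v :: banach \<Rightarrow> 'v"
    and \<rho> :: "'g \<Rightarrow> 'v \<Rightarrow> 'v" and M :: real
  assumes prob_space_\<mu>: "prob_space \<mu>" and space_\<mu>: "space \<mu> = C"
    and banach_space_over_smul: "banach_space_over smul"
    and operators: "c \<in> C \<Longrightarrow> \<rho> c \<in> bounded_operators smul"
    and M_nonneg: "0 \<le> M"
    and norm_\<rho>_le: "c \<in> C \<Longrightarrow> norm (\<rho> c v) \<le> M * norm v"
    and \<rho>_one: "\<exists>e\<in>C. \<rho> e = id"
    and \<rho>_mult: "c \<in> C \<Longrightarrow> d \<in> C \<Longrightarrow> \<exists>e\<in>C. \<rho> c \<circ> \<rho> d = \<rho> e"
    and measurable_functional: "bounded_linear (f :: 'v \<Rightarrow> real) \<Longrightarrow> (\<lambda>g. f (\<rho> g v)) \<in> borel_measurable \<mu>"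
    and markov_value_exists: "\<exists>w. is_markov_value \<mu> smul \<rho> v w"
    and stationary_separate: "\<phi> \<in> dual_space smul \<Longrightarrow> \<phi> \<noteq> (\<lambda>v. 0) \<Longrightarrow>
       \<phi> \<circ> markov_operator \<mu> smul \<rho> = \<phi> \<Longrightarrow> \<exists>v \<in> stationary_vectors \<mu> smul \<rho>. \<phi> v \<noteq> 0"
begin

interpretation prob_space \<mu> by (rule prob_space_\<mu>)
interpretation smul: banach_space_over smul by (rule banach_space_over_smul)

abbreviation P :: "'v \<Rightarrow> 'v" where "P \<equiv> markov_operator \<mu> smul \<rho>"
abbreviation E :: "'v \<Rightarrow> 'v" where "E \<equiv> mean_projection \<mu> smul \<rho>"

section \<open>The Markov operator and its powers\<close>

lemma bounded_linear_\<rho>: "c \<in> C \<Longrightarrow> bounded_linear (\<rho> c)"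
  and \<rho>_smul: "c \<in> C \<Longrightarrow> \<rho> c (smul a v) = smul a (\<rho> c v)"
  using operators[of c] by (auto simp: bounded_operators_def)

lemma integrable_functional:
  fixes f :: "'v \<Rightarrow> 'b::euclidean_space"
  assumes f: "bounded_linear f"
  shows "integrable \<mu> (\<lambda>g. f (\<rho> g v))"
proof -
  obtain K where K: "\<And>x. norm (f x) \<le> norm x * K" and "K > 0"
    using bounded_linear.pos_bounded[OF f] by blast
  have 1: "AE g in \<mu>. norm (f (\<rho> g v)) \<le> M * norm v * K"
    using K \<open>K > 0\<close> norm_\<rho>_le
    by (intro AE_I2) (metis (no_types, lifting) space_\<mu> mult_right_mono order_trans less_imp_le)
  have "bounded_linear (\<lambda>v. inner (f v) i)" for i
    by (intro bounded_linear_compose[OF bounded_linear_inner_left] f)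
  from measurable_functional[OF this, where v = v]
  have "(\<lambda>g. f (\<rho> g v)) \<in> borel_measurable \<mu>"
    by (subst borel_measurable_euclidean_space) auto
  with 1 show ?thesis by (rule integrable_const_bound)
qed

text \<open>Writing \<open>f\<close> as \<open>inner (\<phi> v) 1\<close> and moving the inner
  product through the integral makes the real Hahn-Banach theorem usable over either scalar
  field.\<close>

lemma markov_value_real:
  assumes "is_markov_value \<mu> smul \<rho> v w" and f: "bounded_linear (f :: 'v \<Rightarrow> real)"
  shows "f w = (\<integral>g. f (\<rho> g v) \<partial>\<mu>)"
proof -
  obtain \<phi> where \<phi>: "\<phi> \<in> dual_space smul" and "\<And>c v. inner (c * \<phi> v) 1 = f (smul c v)"
    using real_functional_eq_inner_dual[OF banach_space_over_smul f] by blast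
  from this(2)[of 1] have f_eq: "f v = inner (\<phi> v) 1" for v by simp
  have "integrable \<mu> (\<lambda>g. \<phi> (\<rho> g v))"
    using \<phi> by (intro integrable_functional) (auto simp: dual_space_def)
  then have "(\<integral>g. f (\<rho> g v) \<partial>\<mu>) = inner (\<integral>g. \<phi> (\<rho> g v) \<partial>\<mu>) 1"
    unfolding f_eq by simp
  also have "(\<integral>g. \<phi> (\<rho> g v) \<partial>\<mu>) = \<phi> w"
    using assms(1) \<phi> by (simp add: is_markov_value_def)
  finally show ?thesis by (simp add: f_eq)
qed

text \<open>Real functionals separate points, so the Markov value is unique and the definite
  description denotes it.\<close>

lemma P_real:
  assumes "bounded_linear (f :: 'v \<Rightarrow> real)"
  shows "f (P v) = (\<integral>g. f (\<rho> g v) \<partial>\<mu>)"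
proof -
  obtain w where w: "is_markov_value \<mu> smul \<rho> v w" using markov_value_exists by blast
  have "w' = w" if "is_markov_value \<mu> smul \<rho> v w'" for w'
    by (rule eq_if_functionals_eq) (simp add: markov_value_real[OF that] markov_value_real[OF w])
  then have "P v = w"
    unfolding markov_operator_def by (rule the_equality[where P = "is_markov_value \<mu> smul \<rho> v", OF w])
  then show ?thesis using markov_value_real[OF w assms] by simp
qed

lemma P_add: "P (v + w) = P v + P w"
proof (rule eq_if_functionals_eq)
  fix f :: "'v \<Rightarrow> real"
  assume f: "bounded_linear f"
  interpret f: bounded_linear f by fact
  have "f (P (v + w)) = (\<integral>g. f (\<rho> g v) + f (\<rho> g w) \<partial>\<mu>)"
    unfolding P_real[OF f] using space_\<mu> bounded_linear_\<rho>
    by (intro Bochner_Integration.integral_cong)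
      (auto simp: bounded_linear.linear linear_add f.add)
  then show "f (P (v + w)) = f (P v + P w)"
    by (simp add: f.add P_real[OF f] integrable_functional f)
qed

text \<open>\<open>f \<circ> B\<close> is again a functional, so \<open>B\<close> moves inside the
  integral. It is used for scalar multiplication and, through \<open>E_commute\<close>, for the
  action of \<open>N\<close>.\<close>

lemma P_commute:
  assumes B: "bounded_linear B" and comm: "\<And>c v. c \<in> C \<Longrightarrow> B (\<rho> c v) = \<rho> c (B v)"
  shows "B (P v) = P (B v)"
proof (rule eq_if_functionals_eq)
  fix f :: "'v \<Rightarrow> real"
  assume f: "bounded_linear f"
  have "f (B (P v)) = (\<integral>g. f (B (\<rho> g v)) \<partial>\<mu>)"
    using P_real[OF bounded_linear_compose[OF f B]] .
  also have "\<dots> = (\<integral>g. f (\<rho> g (B v)) \<partial>\<mu>)"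
    using space_\<mu> comm by (intro Bochner_Integration.integral_cong) auto
  finally show "f (B (P v)) = f (P (B v))" by (simp add: P_real[OF f])
qed

lemma P_smul: "P (smul c v) = smul c (P v)"
  using P_commute[OF smul.bounded_linear_smul] by (simp add: \<rho>_smul)

text \<open>This transfers the stationarity hypothesis from functionals over the scalar field to
  real ones. The associated \<open>\<phi>\<close> inherits invariance from \<open>f\<close> because
  \<open>P\<close> respects scalars.\<close>

lemma stationary_separate_real:
  assumes f: "bounded_linear (f :: 'v \<Rightarrow> real)" and "f v \<noteq> 0" and inv: "\<And>v. f (P v) = f v"
  obtains w where "P w = w" "f w \<noteq> 0"
proof -
  obtain \<phi> where \<phi>: "\<phi> \<in> dual_space smul" "\<And>c v. inner (c * \<phi> v) 1 = f (smul c v)"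
    using real_functional_eq_inner_dual[OF banach_space_over_smul f] by blast
  have "\<phi> (P v) = \<phi> v" for v
  proof (rule ccontr)
    assume "\<phi> (P v) \<noteq> \<phi> v"
    \<comment> \<open>Scaling a nonzero difference to \<open>1\<close> gives pairing
      \<open>1\<close>, whereas invariance of \<open>f\<close> at the scaled vectors gives
      \<open>0\<close>.\<close>
    then have "inner (inverse (\<phi> (P v) - \<phi> v) * (\<phi> (P v) - \<phi> v)) 1 = 1"
      by (simp add: dot_square_norm)
    then show False
      using inv[of "smul c v" for c] unfolding right_diff_distrib inner_diff_left \<phi>(2)
      by (simp add: P_smul)
  qed
  then have "\<phi> \<circ> P = \<phi>" by auto
  moreover have "\<phi> \<noteq> (\<lambda>v. 0)" using \<phi>(2)[of 1 v] \<open>f v \<noteq> 0\<close> by auto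
  ultimately obtain w where w: "P w = w" "\<phi> w \<noteq> 0"
    using stationary_separate[OF \<phi>(1)] by (auto simp: stationary_vectors_def)
  \<comment> \<open>\<open>f w\<close> itself may vanish, for example when \<open>\<phi> w\<close>
    is purely imaginary; rescaling \<open>w\<close> makes \<open>\<phi>\<close> equal to
    \<open>1\<close> there.\<close>
  have "P (smul (inverse (\<phi> w)) w) = smul (inverse (\<phi> w)) w" by (simp add: P_smul w)
  moreover have "f (smul (inverse (\<phi> w)) w) \<noteq> 0" using w(2) by (simp flip: \<phi>(2))
  ultimately show thesis using that by blast
qed

text \<open>Half-spaces that contain an orbit of tuples also contain its images under powers of
  \<open>P\<close>: one factor \<open>P\<close> is an integral over the orbit, and the others are
  handled by induction with \<open>f i \<circ> \<rho> c\<close> in place of \<open>f i\<close>. The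
  sums over \<open>I\<close> allow several vectors to be treated at once.\<close>

lemma P_pow_le:
  fixes f :: "'i \<Rightarrow> 'v \<Rightarrow> real"
  assumes "\<And>i. i \<in> I \<Longrightarrow> bounded_linear (f i)"
    and "\<And>c. c \<in> C \<Longrightarrow> (\<Sum>i\<in>I. f i (\<rho> c (v i))) \<le> \<alpha>"
  shows "(\<Sum>i\<in>I. f i ((P ^^ k) (v i))) \<le> \<alpha>"
  using assms
proof (induction k arbitrary: f)
  case 0
  then show ?case using \<rho>_one by fastforce
next
  case (Suc k)
  have *: "(\<Sum>i\<in>I. f i (\<rho> c ((P ^^ k) (v i)))) \<le> \<alpha>" if c: "c \<in> C" for c
  proof (rule Suc.IH[of "\<lambda>i v. f i (\<rho> c v)"])
    show "bounded_linear (\<lambda>v. f i (\<rho> c v))" if "i \<in> I" for i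
      using Suc.prems(1)[OF that] bounded_linear_\<rho>[OF c] by (rule bounded_linear_compose)
    show "(\<Sum>i\<in>I. f i (\<rho> c (\<rho> d (v i)))) \<le> \<alpha>" if d: "d \<in> C" for d
    proof -
      obtain e where "e \<in> C" and e: "\<rho> c \<circ> \<rho> d = \<rho> e" using \<rho>_mult[OF c d] by blast
      from Suc.prems(2)[OF this(1)] show ?thesis by (simp flip: e)
    qed
  qed
  have "(\<Sum>i\<in>I. f i ((P ^^ Suc k) (v i))) = (\<integral>g. (\<Sum>i\<in>I. f i (\<rho> g ((P ^^ k) (v i)))) \<partial>\<mu>)"
    using Suc.prems(1) by (simp add: P_real integrable_functional)
  also have "\<dots> \<le> \<alpha>"
    using * Suc.prems(1) space_\<mu>
    by (intro integral_le_const Bochner_Integration.integrable_sum integrable_functional) auto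
  finally show ?case .
qed

text \<open>Iterating a one-step estimate would give \<open>M ^ k\<close>. A norming functional in
  \<open>P_pow_le\<close> keeps the constant \<open>M\<close>, which makes the averages uniformly
  bounded.\<close>

lemma norm_P_pow_le: "norm ((P ^^ k) v) \<le> M * norm v"
proof -
  obtain f :: "'v \<Rightarrow> real"
    where f: "bounded_linear f" "\<And>x. \<bar>f x\<bar> \<le> norm x" "f ((P ^^ k) v) = norm ((P ^^ k) v)"
    using norming_functional by blast
  have "f (\<rho> c v) \<le> M * norm v" if "c \<in> C" for c
    using f(2)[of "\<rho> c v"] norm_\<rho>_le[OF that, of v] by simp
  then show ?thesis
    using P_pow_le[of "{()}" "\<lambda>_. f" "\<lambda>_. v" "M * norm v" k] f by simp
qed

lemma norm_P_le: "norm (P v) \<le> M * norm v"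
  using norm_P_pow_le[of 1] by simp

lemma bounded_linear_P: "bounded_linear P"
proof (rule bounded_linear_intro[where K = M])
  show "P (r *\<^sub>R v) = r *\<^sub>R P v" for r v
    using P_smul[of "of_real r" v] by (simp add: smul.scale_of_real)
qed (use norm_P_le in \<open>simp_all add: P_add mult.commute\<close>)

lemma bounded_linear_P_pow: "bounded_linear (P ^^ k)"
proof (induction k)
  case (Suc k)
  then show ?case
    using bounded_linear_compose[OF bounded_linear_P] by (simp add: comp_def)
qed (simp add: bounded_linear_ident id_def)

section \<open>Convergence of the ergodic averages\<close>

definition avg :: "nat \<Rightarrow> 'v \<Rightarrow> 'v" where
  "avg n v = (1 / real n) *\<^sub>R (\<Sum>i<n. (P ^^ i) v)"

lemma bounded_linear_avg: "bounded_linear (avg n)"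
  unfolding avg_def
  by (intro bounded_linear_compose[OF bounded_linear_scaleR_right] bounded_linear_sum
      bounded_linear_P_pow)

lemma norm_avg_le: "norm (avg n v) \<le> M * norm v"
proof -
  have "norm (\<Sum>i<n. (P ^^ i) v) \<le> (\<Sum>i<n. M * norm v)"
    by (intro order_trans[OF norm_sum] sum_mono norm_P_pow_le)
  then show ?thesis
    using M_nonneg by (cases "n = 0") (simp_all add: avg_def field_simps)
qed

lemma avg_stationary: "P v = v \<Longrightarrow> 0 < n \<Longrightarrow> avg n v = v"
proof -
  assume "P v = v" "0 < n"
  then have "(P ^^ i) v = v" for i by (induction i) auto
  then show ?thesis using \<open>0 < n\<close> by (simp add: avg_def sum_constant_scaleR)
qed

text \<open>The sum telescopes to \<open>w - (P ^^ n) w\<close>, which is bounded in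
  \<open>n\<close> and is divided by \<open>n\<close>.\<close>

lemma avg_coboundary: "(\<lambda>n. avg n (w - P w)) \<longlonglongrightarrow> 0"
proof (rule tendsto_norm_zero_cancel, rule Lim_null_comparison)
  have "avg n (w - P w) = (1 / real n) *\<^sub>R (w - (P ^^ n) w)" for n
  proof -
    have "(P ^^ i) (w - P w) = (P ^^ i) w - (P ^^ Suc i) w" for i
      using bounded_linear_P_pow by (simp add: bounded_linear.linear linear_diff funpow_swap1)
    then have "(\<Sum>i<n. (P ^^ i) (w - P w)) = (\<Sum>i<n. (P ^^ i) w - (P ^^ Suc i) w)" by simp
    also have "\<dots> = w - (P ^^ n) w" using sum_lessThan_telescope'[of "\<lambda>i. (P ^^ i) w" n] by simp
    finally show ?thesis by (simp add: avg_def)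
  qed
  then have "norm (avg n (w - P w)) \<le> (norm w + M * norm w) * inverse (real n)" for n
    using norm_triangle_ineq4[of w "(P ^^ n) w"] norm_P_pow_le[of n w]
    by (simp add: divide_inverse mult.commute mult_left_mono)
  then show "\<forall>\<^sub>F n in sequentially. norm (norm (avg n (w - P w))) \<le> (norm w + M * norm w) * inverse (real n)"
    by simp
  show "(\<lambda>n. (norm w + M * norm w) * inverse (real n)) \<longlonglongrightarrow> 0"
    by (intro tendsto_mult_right_zero lim_inverse_n)
qed

text \<open>A functional that kills all \<open>w - P w\<close> is \<open>P\<close>-invariant. If it
  is nonzero, weak unique stationarity provides a fixed vector on which it does not vanish, so no
  nonzero functional annihilates the whole subspace.\<close>

lemma stationary_plus_coboundaries_dense:
  "closure {v + (w - P w) | v w. P v = v} = UNIV" (is "closure ?M = UNIV")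
proof (rule ccontr)
  interpret P: bounded_linear P by (rule bounded_linear_P)
  assume "closure ?M \<noteq> UNIV"
  then obtain z where z: "z \<notin> closure ?M" by blast
  have "subspace ?M"
  proof (rule subspaceI)
    show "0 \<in> ?M" by (intro CollectI exI[of _ 0]) (simp add: P.zero)
    show "x + y \<in> ?M" if xy: "x \<in> ?M" "y \<in> ?M" for x y
    proof -
      obtain v w v' w' where "x = v + (w - P w)" "P v = v" "y = v' + (w' - P w')" "P v' = v'"
        using xy by blast
      then have "x + y = (v + v') + ((w + w') - P (w + w'))" "P (v + v') = v + v'"
        by (simp_all add: P.add)
      then show ?thesis by blast
    qed
    show "c *\<^sub>R x \<in> ?M" if x: "x \<in> ?M" for c x
    proof -
      obtain v w where "x = v + (w - P w)" "P v = v" using x by blast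
      then have "c *\<^sub>R x = c *\<^sub>R v + (c *\<^sub>R w - P (c *\<^sub>R w))" "P (c *\<^sub>R v) = c *\<^sub>R v"
        by (simp_all add: P.scaleR scaleR_add_right scaleR_diff_right)
      then show ?thesis by blast
    qed
  qed
  then obtain f :: "'v \<Rightarrow> real" where f: "bounded_linear f" "\<And>m. m \<in> ?M \<Longrightarrow> f m = 0" "f z \<noteq> 0"
    using annihilator_of_non_dense_subspace[OF _ z] by blast
  have "f (P v) = f v" for v
  proof -
    have "v - P v \<in> ?M" by (intro CollectI exI[of _ 0] exI[of _ v]) (simp add: P.zero)
    from f(2)[OF this] show ?thesis using f(1) by (simp add: bounded_linear.linear linear_diff)
  qed
  then obtain w where w: "P w = w" "f w \<noteq> 0"
    using stationary_separate_real[OF f(1,3)] by blast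
  then have "w \<in> ?M" by (intro CollectI exI[of _ w] exI[of _ 0]) (simp add: P.zero)
  from f(2)[OF this] w(2) show False by simp
qed

text \<open>The averages converge on a dense subspace and share the bound \<open>M\<close>, so they
  are Cauchy everywhere, and completeness of \<open>V\<close> gives the limit.\<close>

lemma avg_tendsto: "(\<lambda>n. avg n v) \<longlonglongrightarrow> E v"
proof -
  have "Cauchy (\<lambda>n. avg n v)"
  proof (rule CauchyI')
    fix e :: real
    assume "0 < e"
    \<comment> \<open>Dividing by \<open>M + 1\<close> gives \<open>M * d \<le> e / 3\<close> and
      also covers \<open>M = 0\<close>.\<close>
    define d where "d = e / (3 * (M + 1))"
    have "0 < d" "M * d \<le> e / 3" using \<open>0 < e\<close> M_nonneg by (simp_all add: d_def field_simps)
    obtain m where m: "m \<in> {v + (w - P w) | v w. P v = v}" "dist m v < d"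
      using stationary_plus_coboundaries_dense closure_approachable[of v] \<open>0 < d\<close> by blast
    then obtain u w where uw: "m = u + (w - P w)" "P u = u" by blast
    have close: "dist (avg n v) (avg n m) \<le> e / 3" for n
    proof -
      have "dist (avg n v) (avg n m) = norm (avg n (v - m))"
        using bounded_linear_avg by (simp add: dist_norm bounded_linear.linear linear_diff)
      also have "\<dots> \<le> M * norm (v - m)" by (rule norm_avg_le)
      also have "\<dots> \<le> M * d"
        using m(2) M_nonneg by (intro mult_left_mono) (auto simp: dist_norm norm_minus_commute)
      finally show ?thesis using \<open>M * d \<le> e / 3\<close> by simp
    qed
    have "(\<lambda>n. avg n u) \<longlonglongrightarrow> u"
      using avg_stationary[OF uw(2)]
      by (intro tendsto_eventually eventually_sequentiallyI[of 1]) auto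
    then have "(\<lambda>n. avg n u + avg n (w - P w)) \<longlonglongrightarrow> u + 0"
      using avg_coboundary by (rule tendsto_add)
    then have "(\<lambda>n. avg n m) \<longlonglongrightarrow> u"
      using bounded_linear_avg by (simp add: uw(1) bounded_linear.linear linear_add)
    then have "Cauchy (\<lambda>n. avg n m)" by (rule LIMSEQ_imp_Cauchy)
    then obtain N where N: "\<And>i j. N \<le> i \<Longrightarrow> N \<le> j \<Longrightarrow> dist (avg i m) (avg j m) < e / 3"
      using \<open>0 < e\<close> unfolding Cauchy_def by (meson divide_pos_pos zero_less_numeral)
    have "dist (avg i v) (avg j v) < e" if "N \<le> i" "N \<le> j" for i j
      using N[OF that] close[of i] close[of j]
        dist_triangle[of "avg i v" "avg j v" "avg i m"] dist_triangle[of "avg i m" "avg j v" "avg j m"]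
      by (simp add: dist_commute)
    then show "\<exists>N. \<forall>i\<ge>N. \<forall>j>i. dist (avg i v) (avg j v) < e"
      by (meson less_imp_le order_trans)
  qed
  then show ?thesis
    unfolding mean_projection_def avg_def[symmetric]
    by (simp add: Cauchy_convergent convergent_LIMSEQ_iff[symmetric])
qed

section \<open>The limit projection and its approximation by convex combinations\<close>

lemma norm_E_le: "norm (E v) \<le> M * norm v"
  by (rule LIMSEQ_le_const2[OF tendsto_norm[OF avg_tendsto]]) (use norm_avg_le in blast)

lemma bounded_linear_E: "bounded_linear E"
proof (rule bounded_linear_intro[where K = M])
  show "norm (E v) \<le> norm v * M" for v
    using norm_E_le[of v] by (simp add: mult.commute)
  show "E (v + w) = E v + E w" for v w
    using tendsto_add[OF avg_tendsto[of v] avg_tendsto[of w]] bounded_linear_avg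
    by (intro LIMSEQ_unique[OF avg_tendsto]) (simp add: bounded_linear.linear linear_add)
  show "E (r *\<^sub>R v) = r *\<^sub>R E v" for r v
    using tendsto_scaleR[OF tendsto_const[of r] avg_tendsto[of v]] bounded_linear_avg
    by (intro LIMSEQ_unique[OF avg_tendsto]) (simp add: bounded_linear.linear linear_scale)
qed

lemma E_commute:
  assumes B: "bounded_linear B" and comm: "\<And>c v. c \<in> C \<Longrightarrow> B (\<rho> c v) = \<rho> c (B v)"
  shows "B (E v) = E (B v)"
proof -
  have pow: "B ((P ^^ i) v) = (P ^^ i) (B v)" for i
    by (induction i) (simp_all add: P_commute[OF assms])
  have "B (avg n v) = avg n (B v)" for n
    using bounded_linear.linear[OF B] by (simp add: avg_def linear_scale linear_sum pow)
  then show ?thesis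
    using bounded_linear.tendsto[OF B avg_tendsto[of v]] by (intro LIMSEQ_unique[OF _ avg_tendsto]) simp
qed

text \<open>The estimate of \<open>P_pow_le\<close> is averaged over \<open>k < n\<close> and passed
  to the limit; with it, separation can be used against \<open>E\<close>.\<close>

lemma E_le:
  fixes f :: "'i \<Rightarrow> 'v \<Rightarrow> real"
  assumes "\<And>i. i \<in> I \<Longrightarrow> bounded_linear (f i)"
    and "\<And>c. c \<in> C \<Longrightarrow> (\<Sum>i\<in>I. f i (\<rho> c (v i))) \<le> \<alpha>"
  shows "(\<Sum>i\<in>I. f i (E (v i))) \<le> \<alpha>"
proof (rule LIMSEQ_le_const2)
  show "(\<lambda>n. \<Sum>i\<in>I. f i (avg n (v i))) \<longlonglongrightarrow> (\<Sum>i\<in>I. f i (E (v i)))"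
    by (rule tendsto_sum) (rule bounded_linear.tendsto[OF assms(1) avg_tendsto])
  \<comment> \<open>The index \<open>n = 0\<close> is excluded because \<open>avg 0\<close> is zero
    while \<alpha> may be negative.\<close>
  have "(\<Sum>i\<in>I. f i (avg n (v i))) \<le> \<alpha>" if "0 < n" for n
  proof -
    have "f i (avg n (v i)) = (1 / real n) * (\<Sum>k<n. f i ((P ^^ k) (v i)))" if "i \<in> I" for i
      using bounded_linear.linear[OF assms(1)[OF that]]
      by (simp add: avg_def linear_scale linear_sum sum_divide_distrib)
    then have "(\<Sum>i\<in>I. f i (avg n (v i))) = (1 / real n) * (\<Sum>i\<in>I. \<Sum>k<n. f i ((P ^^ k) (v i)))"
      by (simp add: sum_distrib_left)
    also have "\<dots> = (1 / real n) * (\<Sum>k<n. \<Sum>i\<in>I. f i ((P ^^ k) (v i)))"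
      by (subst sum.swap) (rule refl)
    also have "\<dots> \<le> (1 / real n) * (\<Sum>k<n. \<alpha>)"
      using P_pow_le[OF assms] by (intro mult_left_mono sum_mono) auto
    finally show ?thesis using that by simp
  qed
  then show "\<exists>N. \<forall>n\<ge>N. (\<Sum>i\<in>I. f i (avg n (v i))) \<le> \<alpha>"
    by (meson less_eq_Suc_le)
qed

text \<open>If no operator in \<open>D\<close> is \<epsilon>-close to \<open>E\<close> on
  \<open>F\<close>, the error tuples form a convex set away from the origin, and a separating
  functional contradicts \<open>E_le\<close>. Leaving \<open>D\<close> abstract lets it later carry
  a cohomological condition.\<close>

lemma E_approx:
  assumes D: "\<And>c. c \<in> C \<Longrightarrow> \<rho> c \<in> D"
    and convex: "\<And>A B a b. A \<in> D \<Longrightarrow> B \<in> D \<Longrightarrow> 0 \<le> a \<Longrightarrow> 0 \<le> b \<Longrightarrow> a + b = 1 \<Longrightarrow>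
      (\<lambda>v. a *\<^sub>R A v + b *\<^sub>R B v) \<in> D"
    and "finite F" and "0 < \<epsilon>"
  shows "\<exists>A\<in>D. \<forall>v\<in>F. norm (A v - E v) < \<epsilon>"
proof (rule ccontr)
  assume contra: "\<not> ?thesis"
  obtain v and m :: nat where F: "F = v ` {..<m}"
    using \<open>finite F\<close> by (metis finite_imp_nat_seg_image_inj_on lessThan_def)
  \<comment> \<open>\<open>J\<close> realises \<open>m\<close>-tuples of vectors as a subspace of the normed space of bounded functions on \<open>nat\<close>.\<close>
  define J where "J g = Bcontfun (\<lambda>i::nat. if i < m then g i else 0)" for g :: "nat \<Rightarrow> 'v"
  have J: "J g i = (if i < m then g i else 0)" for g i
  proof -
    have "range (\<lambda>i. if i < m then g i else 0) \<subseteq> insert 0 (g ` {..<m})" by auto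
    then have "finite (range (\<lambda>i. if i < m then g i else 0))"
      by (rule finite_subset) simp
    then have "(\<lambda>i. if i < m then g i else 0) \<in> bcontfun"
      by (auto simp: bcontfun_def intro: finite_imp_bounded)
    then show ?thesis by (simp add: J_def Bcontfun_inverse)
  qed
  have J_lin: "J (\<lambda>i. a *\<^sub>R g i + b *\<^sub>R h i) = a *\<^sub>R J g + b *\<^sub>R J h" for a b g h
    by (rule bcontfun_eqI) (simp add: J)
  define S where "S = (\<lambda>A. J (\<lambda>i. A (v i) - E (v i))) ` D"
  have "convex S"
    unfolding convex_def
  proof (intro ballI allI impI)
    fix x y and a b :: real
    assume xy: "x \<in> S" "y \<in> S" and ab: "0 \<le> a" "0 \<le> b" "a + b = 1"
    obtain A B where A: "A \<in> D" "x = J (\<lambda>i. A (v i) - E (v i))"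
      and B: "B \<in> D" "y = J (\<lambda>i. B (v i) - E (v i))"
      using xy by (auto simp: S_def)
    have "a *\<^sub>R E w + b *\<^sub>R E w = E w" for w using ab(3) by (simp flip: scaleR_add_left)
    then have "a *\<^sub>R (A w - E w) + b *\<^sub>R (B w - E w) = (a *\<^sub>R A w + b *\<^sub>R B w) - E w" for w
      by (simp add: scaleR_diff_right algebra_simps)
    then have "a *\<^sub>R x + b *\<^sub>R y = J (\<lambda>i. (\<lambda>w. a *\<^sub>R A w + b *\<^sub>R B w) (v i) - E (v i))"
      by (simp add: A B flip: J_lin)
    then show "a *\<^sub>R x + b *\<^sub>R y \<in> S"
      unfolding S_def using convex[OF A(1) B(1) ab] by (rule image_eqI)
  qed
  moreover have "\<epsilon> \<le> norm s" if s: "s \<in> S" for s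
  proof -
    obtain A where A: "A \<in> D" "s = J (\<lambda>i. A (v i) - E (v i))" using s by (auto simp: S_def)
    then obtain i where i: "i < m" "\<epsilon> \<le> norm (A (v i) - E (v i))"
      using contra by (auto simp: F not_less)
    then have "\<epsilon> \<le> norm (s i)" by (simp add: A J)
    also have "\<dots> \<le> norm s" by (rule norm_bounded)
    finally show ?thesis .
  qed
  ultimately obtain f where f: "bounded_linear f" "\<And>s. s \<in> S \<Longrightarrow> \<epsilon> \<le> f s"
    using separate_zero_from_convex by metis
  \<comment> \<open>The separating functional on tuples is split into one functional per coordinate,
    the form that \<open>E_le\<close> accepts.\<close>
  define f' where "f' i w = f (J (\<lambda>j. if j = i then w else 0))" for i w
  have f': "bounded_linear (f' i)" for i
  proof -
    have "bounded_linear (\<lambda>w. J (\<lambda>j. if j = i then w else 0))"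
    proof (rule bounded_linear_intro[where K = 1])
      show "norm (J (\<lambda>j. if j = i then w else 0)) \<le> norm w * 1" for w
        by (rule norm_bound) (simp add: J)
    qed (auto intro!: bcontfun_eqI simp: J)
    then show ?thesis unfolding f'_def by (rule bounded_linear_compose[OF f(1)])
  qed
  have f_J: "f (J g) = (\<Sum>i<m. f' i (g i))" for g
  proof -
    have apply_sum: "(\<Sum>i<k. J (\<lambda>j. if j = i then g i else 0)) j
        = (\<Sum>i<k. J (\<lambda>j. if j = i then g i else 0) j)" for j k
      by (induction k) auto
    have "J g = (\<Sum>i<m. J (\<lambda>j. if j = i then g i else 0))"
      by (rule bcontfun_eqI) (simp add: apply_sum J sum.delta)
    then show ?thesis
      using bounded_linear.linear[OF f(1)] by (simp add: linear_sum f'_def)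
  qed
  have f'_diff: "f' i (x - y) = f' i x - f' i y" for i x y
    using f' by (simp add: bounded_linear.linear linear_diff)
  \<comment> \<open>Each \<open>\<rho> c\<close> lies in \<open>D\<close>, so its error tuple has
    \<open>f\<close>-value at least \<epsilon>. \<open>E_le\<close>, applied to the negated
    functionals, transfers this gap to \<open>E\<close> itself.\<close>
  have "(\<Sum>i<m. - f' i (E (v i))) \<le> (\<Sum>i<m. - f' i (E (v i))) - \<epsilon>"
  proof (rule E_le)
    show "(\<Sum>i<m. - f' i (\<rho> c (v i))) \<le> (\<Sum>i<m. - f' i (E (v i))) - \<epsilon>" if "c \<in> C" for c
      using f(2)[of "J (\<lambda>i. \<rho> c (v i) - E (v i))"] D[OF that]
      by (simp add: S_def f_J f'_diff sum_subtractf sum_negf)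
  qed (auto intro: bounded_linear_minus f')
  then show False using \<open>0 < \<epsilon>\<close> by simp
qed

end

text \<open>Approximation on a finite net of \<open>S\<close> suffices, since \<open>E\<close> and
  all members of \<open>D\<close> satisfy the bound \<open>M\<close> and so move little within each
  ball.\<close>

lemma (in markov_module) E_approx_compact:
  assumes D: "\<And>c. c \<in> C \<Longrightarrow> \<rho> c \<in> D"
    and convex: "\<And>A B a b. A \<in> D \<Longrightarrow> B \<in> D \<Longrightarrow> 0 \<le> a \<Longrightarrow> 0 \<le> b \<Longrightarrow> a + b = 1 \<Longrightarrow>
      (\<lambda>v. a *\<^sub>R A v + b *\<^sub>R B v) \<in> D"
    and bounded: "\<And>A. A \<in> D \<Longrightarrow> bounded_linear A" "\<And>A v. A \<in> D \<Longrightarrow> norm (A v) \<le> M * norm v"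
    and "compact S" and "0 < \<epsilon>"
  shows "\<exists>A\<in>D. \<forall>v\<in>S. norm (A v - E v) < \<epsilon>"
proof -
  define \<delta> where "\<delta> = \<epsilon> / (3 * (M + 1))"
  have \<delta>: "0 < \<delta>" "M * \<delta> \<le> \<epsilon> / 3" using \<open>0 < \<epsilon>\<close> M_nonneg by (simp_all add: \<delta>_def field_simps)
  obtain F where F: "finite F" "S \<subseteq> (\<Union>v\<in>F. ball v \<delta>)"
    using \<open>compact S\<close> \<delta>(1) unfolding compact_eq_totally_bounded by metis
  have "\<exists>A\<in>D. \<forall>v\<in>F. norm (A v - E v) < \<epsilon> / 3"
    using D convex F(1) \<open>0 < \<epsilon>\<close> by (intro E_approx) auto
  then obtain A where A: "A \<in> D" "\<And>v. v \<in> F \<Longrightarrow> norm (A v - E v) < \<epsilon> / 3" by blast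
  have "norm (A v - E v) < \<epsilon>" if v: "v \<in> S" for v
  proof -
    obtain w where w: "w \<in> F" "norm (v - w) \<le> \<delta>"
      using F(2) v by (force simp: dist_norm norm_minus_commute)
    then have "M * norm (v - w) \<le> \<epsilon> / 3"
      using \<delta>(2) mult_left_mono[OF w(2) M_nonneg] by linarith
    then have "norm (A (v - w)) \<le> \<epsilon> / 3" "norm (E (v - w)) \<le> \<epsilon> / 3"
      using bounded(2)[OF A(1), of "v - w"] norm_E_le[of "v - w"] by linarith+
    moreover have "norm (A v - E v) = norm (A (v - w) - E (v - w) + (A w - E w))"
      using bounded(1)[OF A(1)] bounded_linear_E by (simp add: bounded_linear.linear linear_diff)
    moreover have "norm (A (v - w) - E (v - w) + (A w - E w)) \<le>
        norm (A (v - w)) + norm (E (v - w)) + norm (A w - E w)"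
      using norm_triangle_ineq[of "A (v - w) - E (v - w)" "A w - E w"]
        norm_triangle_ineq4[of "A (v - w)" "E (v - w)"] by linarith
    ultimately show ?thesis using A(2)[OF w(1)] by linarith
  qed
  then show ?thesis using A(1) by blast
qed

section \<open>Cochains\<close>

text \<open>Here \<open>a i l\<close> stands for the value of a cochain on face \<open>l\<close> of
  prism \<open>i\<close>, \<open>e i k\<close> for its value on prism \<open>i\<close> over face
  \<open>k\<close> of the base, and \<open>w i\<close> for its value on the simplex translated from
  vertex \<open>i\<close> onwards. The diagonal faces telescope, and the others assemble to the
  prisms over the faces.\<close>

lemma prism_sum:
  fixes a e :: "nat \<Rightarrow> nat \<Rightarrow> 'v::real_vector" and w :: "nat \<Rightarrow> 'v"
  assumes below: "\<And>i l. i \<le> n \<Longrightarrow> l < i \<Longrightarrow> a i l = e (i - 1) l"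
    and diag: "\<And>i. i \<le> n \<Longrightarrow> a i i = w i" "\<And>i. i \<le> n \<Longrightarrow> a i (Suc i) = w (Suc i)"
    and above: "\<And>i l. i < l \<Longrightarrow> l \<le> n \<Longrightarrow> a i (Suc l) = e i l"
  shows "(\<Sum>i<Suc n. (- 1) ^ i *\<^sub>R (\<Sum>l<Suc (Suc n). (- 1) ^ l *\<^sub>R a i l)) =
    w 0 - w (Suc n) - (\<Sum>k<Suc n. (- 1) ^ k *\<^sub>R (\<Sum>i<n. (- 1) ^ i *\<^sub>R e i k))"
proof -
  \<comment> \<open>\<open>L i\<close> and \<open>U i\<close> collect the faces below and above the
    two diagonal ones.\<close>
  define L where "L i = (\<Sum>l=0..<i. (- 1) ^ l *\<^sub>R e (i - 1) l)" for i
  define U where "U i = (\<Sum>l=Suc i..<Suc n. (- 1) ^ l *\<^sub>R e i l)" for i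
  have inner: "(\<Sum>l<Suc (Suc n). (- 1) ^ l *\<^sub>R a i l) = L i + (- 1) ^ i *\<^sub>R (w i - w (Suc i)) - U i"
    if i: "i \<le> n" for i
  proof -
    have "(\<Sum>l<Suc (Suc n). (- 1) ^ l *\<^sub>R a i l) =
        (\<Sum>l=0..<i. (- 1) ^ l *\<^sub>R a i l) + (\<Sum>l=i..<Suc (Suc n). (- 1) ^ l *\<^sub>R a i l)"
      using i by (subst sum.atLeastLessThan_concat) (auto simp: lessThan_atLeast0)
    also have "(\<Sum>l=0..<i. (- 1) ^ l *\<^sub>R a i l) = L i"
      unfolding L_def using i by (intro sum.cong refl) (simp add: below)
    also have "(\<Sum>l=i..<Suc (Suc n). (- 1) ^ l *\<^sub>R a i l) =
        (- 1) ^ i *\<^sub>R w i - (- 1) ^ i *\<^sub>R w (Suc i) + (\<Sum>l=Suc (Suc i)..<Suc (Suc n). (- 1) ^ l *\<^sub>R a i l)"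
      using i by (simp add: sum.atLeast_Suc_lessThan[of i] sum.atLeast_Suc_lessThan[of "Suc i"] diag
          del: sum.op_ivl_Suc)
    also have "(\<Sum>l=Suc (Suc i)..<Suc (Suc n). (- 1) ^ l *\<^sub>R a i l) = - U i"
      unfolding U_def sum_negf[symmetric] sum.shift_bounds_Suc_ivl
      by (intro sum.cong refl) (simp add: above)
    finally show ?thesis by (simp add: scaleR_diff_right)
  qed
  have "(\<Sum>i<Suc n. (- 1) ^ i *\<^sub>R (\<Sum>l<Suc (Suc n). (- 1) ^ l *\<^sub>R a i l)) =
      (\<Sum>i<Suc n. (- 1) ^ i *\<^sub>R (L i + (- 1) ^ i *\<^sub>R (w i - w (Suc i)) - U i))"
    by (intro sum.cong refl) (use inner in auto)
  also have "\<dots> = (\<Sum>i<Suc n. (- 1) ^ i *\<^sub>R L i) + (\<Sum>i<Suc n. w i - w (Suc i)) -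
      (\<Sum>i<Suc n. (- 1) ^ i *\<^sub>R U i)"
    by (simp add: scaleR_add_right scaleR_diff_right sum.distrib sum_subtractf
        del: sum.lessThan_Suc flip: power_mult_distrib)
  also have "(\<Sum>i<Suc n. w i - w (Suc i)) = w 0 - w (Suc n)"
    by (rule sum_lessThan_telescope')
  \<comment> \<open>\<open>L 0\<close> is empty, and shifting the index by one flips the
    sign.\<close>
  also have "(\<Sum>i<Suc n. (- 1) ^ i *\<^sub>R L i) = - (\<Sum>i<n. (- 1) ^ i *\<^sub>R L (Suc i))"
    by (simp add: sum.lessThan_Suc_shift L_def[of 0] sum_negf del: sum.lessThan_Suc)
  also have "(\<Sum>i<Suc n. (- 1) ^ i *\<^sub>R U i) = (\<Sum>i<n. (- 1) ^ i *\<^sub>R U i)"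
    by (simp add: U_def[of n])
  also have "- (\<Sum>i<n. (- 1) ^ i *\<^sub>R L (Suc i)) + (w 0 - w (Suc n)) - (\<Sum>i<n. (- 1) ^ i *\<^sub>R U i) =
      w 0 - w (Suc n) - (\<Sum>i<n. (- 1) ^ i *\<^sub>R (L (Suc i) + U i))"
    by (simp add: scaleR_add_right sum.distrib)
  \<comment> \<open>\<open>L (Suc i)\<close> covers \<open>k \<le> i\<close> and \<open>U i\<close>
    covers \<open>i < k \<le> n\<close>, so together they give the full sum over
    \<open>k\<close>.\<close>
  also have "(\<Sum>i<n. (- 1) ^ i *\<^sub>R (L (Suc i) + U i)) =
      (\<Sum>i<n. (- 1) ^ i *\<^sub>R (\<Sum>k<Suc n. (- 1) ^ k *\<^sub>R e i k))"
    unfolding L_def U_def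
    by (intro sum.cong refl)
      (simp add: sum.atLeastLessThan_concat lessThan_atLeast0 del: sum.lessThan_Suc sum.op_ivl_Suc)
  also have "\<dots> = (\<Sum>k<Suc n. (- 1) ^ k *\<^sub>R (\<Sum>i<n. (- 1) ^ i *\<^sub>R e i k))"
    unfolding scaleR_sum_right by (subst sum.swap) (simp add: mult.commute del: sum.lessThan_Suc)
  finally show ?thesis .
qed

text \<open>Uniform closeness on a compact set guarantees membership in a given neighbourhood. For a
  subbasic set, the compact image of \<open>K\<close> has a uniform neighbourhood inside
  \<open>U\<close>; intersections take the union of the compact sets and the smaller radius.\<close>

lemma compact_open_neighbourhood:
  fixes u :: "'a \<Rightarrow> 'b::metric_space"
  assumes "openin (compact_open_topology X euclidean) W" and "u \<in> W"
  obtains K e where "compactin X K" "0 < e"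
    "{f \<in> continuous_maps X euclidean. \<forall>x\<in>K. dist (f x) (u x) < e} \<subseteq> W"
proof -
  define B where "B K e = {f \<in> continuous_maps X euclidean. \<forall>x\<in>K. dist (f x) (u x) < e}"
    for K e
  have "generate_topology_on {{f \<in> continuous_maps X euclidean. f ` K \<subseteq> U} | K U.
      compactin X K \<and> openin euclidean U} W"
    using assms(1) unfolding compact_open_topology_def openin_topology_generated_by_iff .
  then have "\<exists>K e. compactin X K \<and> 0 < e \<and> B K e \<subseteq> W"
    using \<open>u \<in> W\<close>
  proof induction
    case (Int W1 W2)
    from Int.IH(1) Int.prems obtain K1 e1 where 1: "compactin X K1" "0 < e1" "B K1 e1 \<subseteq> W1"
      by (metis IntD1)
    from Int.IH(2) Int.prems obtain K2 e2 where 2: "compactin X K2" "0 < e2" "B K2 e2 \<subseteq> W2"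
      by (metis IntD2)
    have "B (K1 \<union> K2) (min e1 e2) \<subseteq> B K1 e1 \<inter> B K2 e2" by (auto simp: B_def)
    also have "\<dots> \<subseteq> W1 \<inter> W2" using 1(3) 2(3) by (rule Int_mono)
    finally have "B (K1 \<union> K2) (min e1 e2) \<subseteq> W1 \<inter> W2" .
    moreover have "compactin X (K1 \<union> K2)" "0 < min e1 e2"
      using 1 2 by (simp_all add: compactin_Un)
    ultimately show ?case by (intro exI conjI)
  next
    case (UN Ws)
    then obtain S where "S \<in> Ws" "u \<in> S" by (elim UnionE)
    with UN.IH[OF this] show ?case by (meson Union_upper order_trans)
  next
    case (Basis S)
    then obtain K U where S: "S = {f \<in> continuous_maps X euclidean. f ` K \<subseteq> U}"
      and K: "compactin X K" and "openin euclidean U" by blast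
    then have "open U" by (intro iffD2[OF open_openin])
    with Basis.prems have u: "continuous_map X euclidean u" "u ` K \<subseteq> U"
      by (auto simp: continuous_maps_def S)
    then have "compact (u ` K)" using image_compactin[OF K u(1)] by simp
    then obtain e where "0 < e" and e: "(\<Union>y\<in>u ` K. ball y e) \<subseteq> U"
      using compact_subset_open_imp_ball_epsilon_subset[OF _ \<open>open U\<close> \<open>u ` K \<subseteq> U\<close>] by metis
    have "B K e \<subseteq> S"
    proof
      fix f
      assume "f \<in> B K e"
      then have f: "f \<in> continuous_maps X euclidean" "\<And>x. x \<in> K \<Longrightarrow> f x \<in> ball (u x) e"
        by (auto simp: B_def dist_commute)
      have "f ` K \<subseteq> (\<Union>y\<in>u ` K. ball y e)" using f(2) by blast
      then show "f \<in> S" unfolding S using f(1) e by blast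
    qed
    then show ?case using K \<open>0 < e\<close> by (intro exI conjI)
  qed simp
  then show thesis using that by (auto simp: B_def)
qed

section \<open>Prisms over simplices and their faces\<close>

text \<open>\<open>prism\<close> is \<open>(x\<^sub>0, \<dots>, x\<^sub>i, x\<^sub>i c, \<dots>, x\<^bsub>n-1\<^esub> c)\<close>.\<close>

definition prism :: "('g, 'm) monoid_scheme \<Rightarrow> nat \<Rightarrow> 'g \<Rightarrow> nat \<Rightarrow> (nat \<Rightarrow> 'g) \<Rightarrow> nat \<Rightarrow> 'g" where
  "prism G n c i x = (\<lambda>j\<in>{..<n + 1}. if j \<le> i then x j else x (j - 1) \<otimes>\<^bsub>G\<^esub> c)"

text \<open>These simplices are the diagonal faces of the prisms. Index \<open>0\<close> translates
  the whole tuple and index \<open>n\<close> leaves it fixed.\<close>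

definition translate_from :: "('g, 'm) monoid_scheme \<Rightarrow> nat \<Rightarrow> 'g \<Rightarrow> nat \<Rightarrow> (nat \<Rightarrow> 'g) \<Rightarrow> nat \<Rightarrow> 'g" where
  "translate_from G n c i x = (\<lambda>j\<in>{..<n}. if j < i then x j else x j \<otimes>\<^bsub>G\<^esub> c)"

text \<open>This and the next two lemmas supply the hypotheses of \<open>prism_sum\<close>. Omitting
  a vertex before the doubled one lowers the position of the doubling by one.\<close>

lemma omit_prism_below:
  "i \<le> n \<Longrightarrow> l < i \<Longrightarrow> omit (n + 1) l (prism G (n + 1) c i x) = prism G n c (i - 1) (omit n l x)"
  by (rule ext) (auto simp: omit_def prism_def)

lemma omit_prism_diag:
  "i \<le> n \<Longrightarrow> omit (n + 1) i (prism G (n + 1) c i x) = translate_from G (n + 1) c i x"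
  "i \<le> n \<Longrightarrow> omit (n + 1) (Suc i) (prism G (n + 1) c i x) = translate_from G (n + 1) c (Suc i) x"
  by (rule ext, auto simp: omit_def prism_def translate_from_def)+

lemma omit_prism_above:
  "i < l \<Longrightarrow> l \<le> n \<Longrightarrow> omit (n + 1) (Suc l) (prism G (n + 1) c i x) = prism G n c i (omit n l x)"
  by (rule ext) (auto simp: omit_def prism_def)

lemma omit_in_PiE: "x \<in> {..<n + 1} \<rightarrow>\<^sub>E A \<Longrightarrow> omit n i x \<in> {..<n} \<rightarrow>\<^sub>E A"
  by (auto simp: omit_def PiE_iff)

lemma continuous_map_bounded_linear:
  assumes "bounded_linear A" and "continuous_map X euclidean f"
  shows "continuous_map X euclidean (\<lambda>x. A (f x))"
proof -
  have "continuous_map X euclidean (A \<circ> f)"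
    using assms by (intro continuous_map_compose[of X euclidean f]) (auto simp: linear_continuous_on)
  then show ?thesis by (simp add: comp_def)
qed

section \<open>Cochains on subgroups and the prism homotopy\<close>

context topological_group
begin

lemma topspace_power: "A \<subseteq> carrier G \<Longrightarrow> topspace (power_topology (subtopology T A) k) = {..<k} \<rightarrow>\<^sub>E A"
  by (auto simp: topspace_eq Int_absorb1)

lemma topspace_power_full: "topspace (power_topology T k) = {..<k} \<rightarrow>\<^sub>E carrier G"
  by (simp add: topspace_eq)

lemma power_subtopology:
  "power_topology (subtopology T A) k = subtopology (power_topology T k) ({..<k} \<rightarrow>\<^sub>E A)"
  by (simp add: subtopology_product_topology)

lemma continuous_map_right_mult:
  assumes "c \<in> carrier G"
  shows "continuous_map T T (\<lambda>x. x \<otimes> c)"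
proof -
  have "continuous_map T (prod_topology T T) (\<lambda>x. (x, c))"
    using assms by (intro continuous_map_pairedI) (auto simp: topspace_eq)
  from continuous_map_compose[OF this continuous_mult] show ?thesis by (simp add: comp_def)
qed

lemma prism_in_PiE:
  "x \<in> {..<n} \<rightarrow>\<^sub>E carrier G \<Longrightarrow> c \<in> carrier G \<Longrightarrow> i < n \<Longrightarrow>
    prism G n c i x \<in> {..<n + 1} \<rightarrow>\<^sub>E carrier G"
  by (auto simp: prism_def PiE_iff)

lemma continuous_map_prism:
  assumes c: "c \<in> carrier G" and i: "i < n"
  shows "continuous_map (power_topology T n) (power_topology T (n + 1)) (prism G n c i)"
  unfolding continuous_map_componentwise
proof (intro conjI ballI)
  show "prism G n c i ` topspace (power_topology T n) \<subseteq> extensional {..<n + 1}"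
    by (auto simp: prism_def)
  fix k
  assume k: "k \<in> {..<n + 1}"
  show "continuous_map (power_topology T n) T (\<lambda>x. prism G n c i x k)"
  proof (cases "k \<le> i")
    case True
    then have "continuous_map (power_topology T n) T (\<lambda>x. x k)"
      using i by (intro continuous_map_product_projection) auto
    then show ?thesis using True k by (simp add: prism_def)
  next
    case False
    then have "continuous_map (power_topology T n) T (\<lambda>x. x (k - 1))"
      using k by (intro continuous_map_product_projection) auto
    from continuous_map_compose[OF this continuous_map_right_mult[OF c]]
    show ?thesis using False k by (simp add: prism_def comp_def)
  qed
qed

lemma prism_left_mult:
  assumes "x \<in> {..<n} \<rightarrow>\<^sub>E carrier G" "c \<in> carrier G" "g \<in> carrier G" "i < n"
  shows "prism G n c i (\<lambda>j\<in>{..<n}. g \<otimes> x j) = (\<lambda>j\<in>{..<n + 1}. g \<otimes> prism G n c i x j)"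
  using assms by (intro ext) (auto simp: prism_def PiE_iff m_assoc)

lemma invariant_cochains_lincomb:
  assumes f: "f \<in> invariant_cochains (G\<lparr>carrier := A\<rparr>) (subtopology T A) \<rho> k"
    and h: "h \<in> invariant_cochains (G\<lparr>carrier := A\<rparr>) (subtopology T A) \<rho> k"
    and A: "subgroup A G" and lin: "\<And>g. g \<in> A \<Longrightarrow> bounded_linear (\<rho> g)"
  shows "(\<lambda>x\<in>topspace (power_topology (subtopology T A) k). a *\<^sub>R f x + b *\<^sub>R h x) \<in>
    invariant_cochains (G\<lparr>carrier := A\<rparr>) (subtopology T A) \<rho> k"
proof -
  let ?X = "power_topology (subtopology T A) k"
  have top: "topspace ?X = {..<k} \<rightarrow>\<^sub>E A"
    using subgroup.subset[OF A] by (rule topspace_power)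
  have "continuous_map ?X euclidean (\<lambda>x. a *\<^sub>R f x + b *\<^sub>R h x)"
    using f h
    by (intro continuous_map_add continuous_map_bounded_linear[OF bounded_linear_scaleR_right])
      (auto simp: invariant_cochains_def cochains_def continuous_maps_def)
  then have "continuous_map ?X euclidean (\<lambda>x\<in>topspace ?X. a *\<^sub>R f x + b *\<^sub>R h x)"
    by (rule continuous_map_eq) simp
  moreover have "(\<lambda>j\<in>{..<k}. g \<otimes> x j) \<in> topspace ?X" if "g \<in> A" "x \<in> topspace ?X" for g x
    using that subgroup.m_closed[OF A] unfolding top by (auto simp: PiE_iff)
  ultimately show ?thesis
    using f h lin
    by (auto simp: invariant_cochains_def cochains_def continuous_maps_def
        bounded_linear.linear linear_add linear_scale simp del: topspace_product_topology)
qed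

text \<open>Linearity preserves the cocycle equation, boundedness continuity, and commutation with
  \<open>N\<close> invariance. The identity, \<open>E\<close> and the operators approximating
  \<open>E\<close> are the cases used.\<close>

lemma cocycles_operator:
  assumes b: "b \<in> cocycles G T \<rho> n" and N: "subgroup N G" and A: "bounded_linear A"
    and comm: "\<And>g v. g \<in> N \<Longrightarrow> A (\<rho> g v) = \<rho> g (A v)"
  shows "restrict (A \<circ> b) (topspace (power_topology (subtopology T N) (n + 1)))
    \<in> cocycles (G\<lparr>carrier := N\<rparr>) (subtopology T N) \<rho> n"
proof -
  interpret A: bounded_linear A by fact
  have sub: "N \<subseteq> carrier G" using N by (rule subgroup.subset)
  note top = topspace_power[OF sub]
  have mono: "{..<k} \<rightarrow>\<^sub>E N \<subseteq> {..<k} \<rightarrow>\<^sub>E carrier G" for k :: nat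
    using sub by (intro PiE_mono) auto
  have cont: "continuous_map (power_topology T (n + 1)) euclidean b"
    and inv: "\<And>g x. g \<in> carrier G \<Longrightarrow> x \<in> {..<n + 1} \<rightarrow>\<^sub>E carrier G \<Longrightarrow>
      b (\<lambda>i\<in>{..<n + 1}. g \<otimes> x i) = \<rho> g (b x)"
    and cocycle: "\<And>x. x \<in> {..<n + 2} \<rightarrow>\<^sub>E carrier G \<Longrightarrow> coboundary T (n + 1) b x = 0"
    using b unfolding cocycles_def invariant_cochains_def cochains_def continuous_maps_def topspace_power_full
    by auto
  have "continuous_map (power_topology (subtopology T N) (n + 1)) euclidean b"
    unfolding power_subtopology using cont by (rule continuous_map_from_subtopology)
  from continuous_map_bounded_linear[OF A this]
  have "continuous_map (power_topology (subtopology T N) (n + 1)) euclidean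
      (restrict (A \<circ> b) ({..<n + 1} \<rightarrow>\<^sub>E N))"
    by (rule continuous_map_eq) (simp only: top restrict_apply' comp_apply)
  moreover have "restrict (A \<circ> b) ({..<n + 1} \<rightarrow>\<^sub>E N) (\<lambda>i\<in>{..<n + 1}. g \<otimes> x i) =
      \<rho> g (restrict (A \<circ> b) ({..<n + 1} \<rightarrow>\<^sub>E N) x)"
    if g: "g \<in> N" and x: "x \<in> {..<n + 1} \<rightarrow>\<^sub>E N" for g x
  proof -
    have gx: "(\<lambda>i\<in>{..<n + 1}. g \<otimes> x i) \<in> {..<n + 1} \<rightarrow>\<^sub>E N"
      using g x subgroup.m_closed[OF N] by (auto simp: PiE_iff)
    have "b (\<lambda>i\<in>{..<n + 1}. g \<otimes> x i) = \<rho> g (b x)"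
      using g x sub mono by (intro inv) auto
    then show ?thesis
      by (simp only: restrict_apply'[OF gx] restrict_apply'[OF x] comp_apply comm[OF g])
  qed
  moreover have "coboundary (subtopology T N) (n + 1)
      (restrict (A \<circ> b) ({..<n + 1} \<rightarrow>\<^sub>E N)) x = 0" if x: "x \<in> {..<n + 2} \<rightarrow>\<^sub>E N" for x
  proof -
    have x': "x \<in> {..<n + 1 + 1} \<rightarrow>\<^sub>E N" "x \<in> {..<n + 1 + 1} \<rightarrow>\<^sub>E carrier G"
      using x mono[of "n + 2"] by auto
    have om: "omit (n + 1) i x \<in> {..<n + 1} \<rightarrow>\<^sub>E N" for i using x'(1) by (rule omit_in_PiE)
    have "coboundary (subtopology T N) (n + 1) (restrict (A \<circ> b) ({..<n + 1} \<rightarrow>\<^sub>E N)) x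
        = (\<Sum>i<n + 1 + 1. (- 1) ^ i *\<^sub>R A (b (omit (n + 1) i x)))"
      unfolding coboundary_def top restrict_apply'[OF x'(1)]
      by (intro sum.cong refl) (simp only: restrict_apply'[OF om] comp_apply)
    also have "\<dots> = A (coboundary T (n + 1) b x)"
      unfolding coboundary_def topspace_power_full restrict_apply'[OF x'(2)]
      by (simp only: A.sum A.scaleR)
    also have "\<dots> = 0" using cocycle[of x] x mono[of "n + 2"] by (auto simp: A.zero)
    finally show ?thesis .
  qed
  ultimately show ?thesis
    unfolding cocycles_def invariant_cochains_def cochains_def continuous_maps_def top
    by (simp del: topspace_product_topology)
qed

text \<open>On \<open>N\<close>, left translation by \<open>c\<close> is right translation, and the alternating sum of prisms is a chain
  homotopy between right translation and the identity. It is invariant because right translation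
  commutes with left translation.\<close>

lemma translate_minus_id_coboundary:
  assumes b: "b \<in> cocycles G T \<rho> n" and N: "subgroup N G" and c: "c \<in> carrier G"
    and comm: "\<And>x. x \<in> N \<Longrightarrow> x \<otimes> c = c \<otimes> x"
    and lin: "\<And>g. g \<in> N \<Longrightarrow> bounded_linear (\<rho> g)"
  shows "\<exists>h \<in> invariant_cochains (G\<lparr>carrier := N\<rparr>) (subtopology T N) \<rho> n.
    \<forall>x \<in> topspace (power_topology (subtopology T N) (n + 1)).
      coboundary (subtopology T N) n h x = \<rho> c (b x) - b x"
proof -
  have sub: "N \<subseteq> carrier G" using N by (rule subgroup.subset)
  note top = topspace_power[OF sub]
  have mono: "{..<k} \<rightarrow>\<^sub>E N \<subseteq> {..<k} \<rightarrow>\<^sub>E carrier G" for k :: nat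
    using sub by (intro PiE_mono) auto
  have cont: "continuous_map (power_topology T (n + 1)) euclidean b"
    and inv: "\<And>g x. g \<in> carrier G \<Longrightarrow> x \<in> {..<n + 1} \<rightarrow>\<^sub>E carrier G \<Longrightarrow>
      b (\<lambda>i\<in>{..<n + 1}. g \<otimes> x i) = \<rho> g (b x)"
    and cocycle: "\<And>x. x \<in> {..<n + 2} \<rightarrow>\<^sub>E carrier G \<Longrightarrow> coboundary T (n + 1) b x = 0"
    using b unfolding cocycles_def invariant_cochains_def cochains_def continuous_maps_def topspace_power_full
    by auto
  \<comment> \<open>For \<open>n = 0\<close> this sum is empty; a 0-cocycle is constant, so
    \<open>\<rho> c (b x) = b x\<close> and a zero primitive is correct.\<close>
  define H where "H x = (\<Sum>i<n. (- 1) ^ i *\<^sub>R b (prism G n c i x))" for x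
  define h where "h = restrict H ({..<n} \<rightarrow>\<^sub>E N)"
  have "continuous_map (power_topology T n) euclidean (\<lambda>x. b (prism G n c i x))" if "i < n" for i
    using continuous_map_compose[OF continuous_map_prism[OF c that] cont] by (simp add: comp_def)
  then have "continuous_map (power_topology T n) euclidean H"
    unfolding H_def
    by (intro continuous_map_sum continuous_map_bounded_linear[OF bounded_linear_scaleR_right]) auto
  then have "continuous_map (power_topology (subtopology T N) n) euclidean H"
    unfolding power_subtopology by (rule continuous_map_from_subtopology)
  then have "continuous_map (power_topology (subtopology T N) n) euclidean h"
    by (rule continuous_map_eq) (simp only: top h_def restrict_apply')
  moreover have "h (\<lambda>i\<in>{..<n}. g \<otimes> x i) = \<rho> g (h x)" if g: "g \<in> N" and x: "x \<in> {..<n} \<rightarrow>\<^sub>E N" for g x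
  proof -
    have gx: "(\<lambda>i\<in>{..<n}. g \<otimes> x i) \<in> {..<n} \<rightarrow>\<^sub>E N"
      using g x subgroup.m_closed[OF N] by (auto simp: PiE_iff)
    have g': "g \<in> carrier G" and x': "x \<in> {..<n} \<rightarrow>\<^sub>E carrier G" using g x sub mono by auto
    have "b (prism G n c i (\<lambda>i\<in>{..<n}. g \<otimes> x i)) = \<rho> g (b (prism G n c i x))" if "i < n" for i
      unfolding prism_left_mult[OF x' c g' that] using g' prism_in_PiE[OF x' c that] by (rule inv)
    then have "H (\<lambda>i\<in>{..<n}. g \<otimes> x i) = \<rho> g (H x)"
      using lin[OF g] by (simp add: H_def bounded_linear.linear linear_sum linear_scale)
    then show ?thesis by (simp only: h_def restrict_apply'[OF gx] restrict_apply'[OF x])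
  qed
  ultimately have "h \<in> invariant_cochains (G\<lparr>carrier := N\<rparr>) (subtopology T N) \<rho> n"
    unfolding invariant_cochains_def cochains_def continuous_maps_def top by (auto simp: h_def)
  moreover have "coboundary (subtopology T N) n h x = \<rho> c (b x) - b x"
    if x: "x \<in> {..<n + 1} \<rightarrow>\<^sub>E N" for x
  proof -
    have x': "x \<in> {..<n + 1} \<rightarrow>\<^sub>E carrier G" using x mono by auto
    \<comment> \<open>The vertices \<open>x j \<otimes> c\<close> may leave \<open>N\<close>, so the
      cocycle equation of \<open>b\<close> on all of \<open>G\<close> is used.\<close>
    have "coboundary T (n + 1) b (prism G (n + 1) c i x) = 0" if "i \<le> n" for i
      using prism_in_PiE[OF x' c, of i] that by (intro cocycle) simp
    moreover have "coboundary T (n + 1) b (prism G (n + 1) c i x) =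
        (\<Sum>l<Suc (Suc n). (- 1) ^ l *\<^sub>R b (omit (n + 1) l (prism G (n + 1) c i x)))" if "i \<le> n" for i
      using prism_in_PiE[OF x' c, of i] that
      unfolding coboundary_def topspace_power_full by (simp del: sum.lessThan_Suc)
    ultimately have "0 = (\<Sum>i<Suc n. (- 1) ^ i *\<^sub>R
        (\<Sum>l<Suc (Suc n). (- 1) ^ l *\<^sub>R b (omit (n + 1) l (prism G (n + 1) c i x))))"
      by (simp del: sum.lessThan_Suc)
    also have "\<dots> = b (translate_from G (n + 1) c 0 x) - b (translate_from G (n + 1) c (Suc n) x) -
        (\<Sum>k<Suc n. (- 1) ^ k *\<^sub>R (\<Sum>i<n. (- 1) ^ i *\<^sub>R b (prism G n c i (omit n k x))))"
      by (rule prism_sum) (simp_all add: omit_prism_below omit_prism_diag omit_prism_above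
          del: One_nat_def add_Suc_right)
    \<comment> \<open>Faces of a simplex in \<open>N\<close> stay in \<open>N\<close>, so
      \<open>h\<close> agrees with \<open>H\<close> on them and the double sum is the coboundary of
      \<open>h\<close>.\<close>
    also have "(\<Sum>k<Suc n. (- 1) ^ k *\<^sub>R (\<Sum>i<n. (- 1) ^ i *\<^sub>R b (prism G n c i (omit n k x)))) =
        coboundary (subtopology T N) n h x"
      using x omit_in_PiE[OF x]
      unfolding coboundary_def top by (simp add: h_def H_def del: sum.lessThan_Suc)
    also have "translate_from G (n + 1) c (Suc n) x = x"
      using x by (intro ext) (auto simp: translate_from_def PiE_iff extensional_def)
    also have "translate_from G (n + 1) c 0 x = (\<lambda>i\<in>{..<n + 1}. c \<otimes> x i)"
      using x comm by (intro ext) (auto simp: translate_from_def PiE_iff)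
    also have "b (\<lambda>i\<in>{..<n + 1}. c \<otimes> x i) = \<rho> c (b x)"
      using c x' by (rule inv)
    finally show ?thesis by simp
  qed
  ultimately show ?thesis unfolding top by blast
qed

end

section \<open>From topological modules to the analytic setting\<close>

lemma borel_measurable_baire:
  assumes "continuous_map X euclideanreal f" and "space \<mu> = topspace X" and "sets \<mu> = baire_algebra X"
  shows "f \<in> borel_measurable \<mu>"
proof (rule measurableI)
  fix A :: "real set"
  assume "A \<in> sets borel"
  then show "f -` A \<inter> space \<mu> \<in> sets \<mu>"
    using assms by (auto simp: baire_algebra_def intro!: sigma_sets.Basic)
qed simp

lemma uniformly_bounded_module_bound:
  assumes "uniformly_bounded_module G smul \<rho>"
  obtains M where "0 \<le> M" "\<And>g v. g \<in> carrier G \<Longrightarrow> norm (\<rho> g v) \<le> M * norm v"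
proof -
  obtain M where M: "\<And>g. g \<in> carrier G \<Longrightarrow> onorm (\<rho> g) \<le> M"
    using assms by (auto simp: uniformly_bounded_module_def bdd_above_def)
  have bl: "bounded_linear (\<rho> g)" if "g \<in> carrier G" for g
    using assms that
    by (auto simp: uniformly_bounded_module_def hom_def Pi_iff GL_def bounded_operators_def)
  show thesis
  proof
    show "norm (\<rho> g v) \<le> max 0 M * norm v" if g: "g \<in> carrier G" for g v
    proof -
      have "norm (\<rho> g v) \<le> onorm (\<rho> g) * norm v" using bl[OF g] by (rule onorm)
      also have "\<dots> \<le> max 0 M * norm v"
        using M[OF g] by (intro mult_right_mono) auto
      finally show ?thesis .
    qed
  qed simp
qed

lemma markov_module_of_weakly_uniquely_stationary:
  assumes G: "topological_group G T" and C: "subgroup C G"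
    and \<mu>: "\<mu> \<in> baire_prob_measures (subtopology T C)"
    and bounded: "uniformly_bounded_module G smul \<rho>"
    and cont: "strongly_operator_continuous T \<rho>"
    and stationary: "weakly_uniquely_stationary (G\<lparr>carrier := C\<rparr>) (subtopology T C) \<mu> smul \<rho>"
    and M: "0 \<le> M" "\<And>g v. g \<in> carrier G \<Longrightarrow> norm (\<rho> g v) \<le> M * norm v"
  shows "markov_module C \<mu> smul \<rho> M"
proof -
  interpret topological_group G T by fact
  have sub: "C \<subseteq> carrier G" using C by (rule subgroup.subset)
  have top: "topspace (subtopology T C) = C" using sub by (auto simp: topspace_eq)
  have hom: "\<rho> \<in> hom G (GL smul)" using bounded by (simp add: uniformly_bounded_module_def)
  have mult: "\<rho> (g \<otimes>\<^bsub>G\<^esub> h) = \<rho> g \<circ> \<rho> h" if "g \<in> carrier G" "h \<in> carrier G" for g h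
    using hom that by (auto simp: hom_def GL_def)
  have GL: "\<rho> g \<in> carrier (GL smul)" if "g \<in> carrier G" for g
    using hom that by (auto simp: hom_def)
  \<comment> \<open>Membership in \<open>hom\<close> records multiplicativity only; the unit acts by
    an invertible idempotent, hence by the identity.\<close>
  have one: "\<rho> \<one>\<^bsub>G\<^esub> = id"
  proof -
    obtain B where B: "\<rho> \<one>\<^bsub>G\<^esub> \<circ> B = id" using GL[OF one_closed] by (auto simp: GL_def)
    have "\<rho> \<one>\<^bsub>G\<^esub> = \<rho> \<one>\<^bsub>G\<^esub> \<circ> (\<rho> \<one>\<^bsub>G\<^esub> \<circ> B)" by (simp add: B)
    also have "\<dots> = \<rho> (\<one>\<^bsub>G\<^esub> \<otimes>\<^bsub>G\<^esub> \<one>\<^bsub>G\<^esub>) \<circ> B" by (simp only: mult one_closed comp_assoc)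
    finally show ?thesis by (simp add: B)
  qed
  have space: "space \<mu> = C" and sets: "sets \<mu> = baire_algebra (subtopology T C)"
    and prob: "prob_space \<mu>"
    using \<mu> top by (auto simp: baire_prob_measures_def)
  show ?thesis
  proof (rule markov_module.intro)
    show "prob_space \<mu>" by fact
    show "space \<mu> = C" by fact
    show "banach_space_over smul" using bounded by (simp add: uniformly_bounded_module_def)
    show "\<rho> c \<in> bounded_operators smul" if "c \<in> C" for c
      using GL[of c] that sub by (auto simp: GL_def)
    show "0 \<le> M" by fact
    show "norm (\<rho> c v) \<le> M * norm v" if "c \<in> C" for c v using M(2) that sub by blast
    show "\<exists>e\<in>C. \<rho> e = id" using one subgroup.one_closed[OF C] by blast
    show "\<exists>e\<in>C. \<rho> c \<circ> \<rho> d = \<rho> e" if "c \<in> C" "d \<in> C" for c d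
      using mult[of c d] subgroup.m_closed[OF C that] that sub
      by (intro bexI[of _ "c \<otimes>\<^bsub>G\<^esub> d"]) (auto simp: subset_iff)
    show "(\<lambda>g. f (\<rho> g v)) \<in> borel_measurable \<mu>" if f: "bounded_linear f" for f :: "_ \<Rightarrow> real" and v
    proof (rule borel_measurable_baire)
      have "continuous_map T euclidean (\<lambda>g. \<rho> g v)"
        using cont by (simp add: strongly_operator_continuous_def)
      from continuous_map_bounded_linear[OF f this]
      show "continuous_map (subtopology T C) euclideanreal (\<lambda>g. f (\<rho> g v))"
        by (rule continuous_map_from_subtopology)
    qed (simp_all only: space top sets)
    show "\<exists>w. is_markov_value \<mu> smul \<rho> v w" for v
      using stationary by (auto simp: weakly_uniquely_stationary_def mu_integrable_def)
    show "\<exists>v\<in>stationary_vectors \<mu> smul \<rho>. \<phi> v \<noteq> 0"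
      if "\<phi> \<in> dual_space smul" "\<phi> \<noteq> (\<lambda>v. 0)" "\<phi> \<circ> markov_operator \<mu> smul \<rho> = \<phi>" for \<phi>
      using stationary that by (auto simp: weakly_uniquely_stationary_def)
  qed
qed

section \<open>Approximation of the averaged cocycle by coboundaries on \<open>N\<close>\<close>

theorem theorem1:
  fixes G :: "('g, 'm) monoid_scheme" and T :: "'g topology"
    and N C :: "'g set" and \<mu> :: "'g measure"
    and smul :: "'k :: {real_normed_field, euclidean_space} \<Rightarrow> 'v :: banach \<Rightarrow> 'v"
    and \<rho> :: "'g \<Rightarrow> 'v \<Rightarrow> 'v"
    and n :: nat and b :: "(nat \<Rightarrow> 'g) \<Rightarrow> 'v"
  assumes "topological_group G T"
    and "subgroup N G" and "subgroup C G"
    and "\<forall>x \<in> N. \<forall>c \<in> C. x \<otimes>\<^bsub>G\<^esub> c = c \<otimes>\<^bsub>G\<^esub> x"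
    and "\<mu> \<in> baire_prob_measures (subtopology T C)"
    and "uniformly_bounded_module G smul \<rho>"
    and "strongly_operator_continuous T \<rho>"
    and "weakly_uniquely_stationary (G\<lparr>carrier := C\<rparr>) (subtopology T C) \<mu> smul \<rho>"
    and "b \<in> cocycles G T \<rho> n"
  shows "restrict (mean_projection \<mu> smul \<rho> \<circ> b)
             (topspace (power_topology (subtopology T N) (n + 1)))
           \<in> cocycles (G\<lparr>carrier := N\<rparr>) (subtopology T N) \<rho> n \<and>
         almost_cohomologous (G\<lparr>carrier := N\<rparr>) (subtopology T N) \<rho> n
           (restrict (mean_projection \<mu> smul \<rho> \<circ> b)
             (topspace (power_topology (subtopology T N) (n + 1))))
           (restrict b (topspace (power_topology (subtopology T N) (n + 1))))"
proof -
  interpret topological_group G T by fact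
  note N = \<open>subgroup N G\<close> and b = \<open>b \<in> cocycles G T \<rho> n\<close>
  have subN: "N \<subseteq> carrier G" and subC: "C \<subseteq> carrier G"
    using assms(2,3) by (simp_all add: subgroup.subset)
  obtain M where M: "0 \<le> M" "\<And>g v. g \<in> carrier G \<Longrightarrow> norm (\<rho> g v) \<le> M * norm v"
    using uniformly_bounded_module_bound[OF assms(6)] by blast
  interpret markov_module C \<mu> smul \<rho> M
    using assms(1,3,5-8) M by (rule markov_module_of_weakly_uniquely_stationary)
  have hom: "\<rho> \<in> hom G (GL smul)" using assms(6) by (simp add: uniformly_bounded_module_def)
  have lin: "bounded_linear (\<rho> g)" if "g \<in> carrier G" for g
    using hom that by (auto simp: hom_def Pi_iff GL_def bounded_operators_def)
  have mult: "\<rho> (g \<otimes>\<^bsub>G\<^esub> h) v = \<rho> g (\<rho> h v)" if "g \<in> carrier G" "h \<in> carrier G" for g h v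
    using hom that by (auto simp: hom_def GL_def)
  have comm: "\<rho> y (\<rho> c v) = \<rho> c (\<rho> y v)" if "y \<in> N" "c \<in> C" for y c v
    using assms(4) that subN subC by (simp add: subset_iff flip: mult)
  have E_comm: "E (\<rho> y v) = \<rho> y (E v)" if "y \<in> N" for y v
    using E_commute[OF lin] comm that subN by (metis subsetD)

  let ?TN = "subtopology T N" and ?GN = "G\<lparr>carrier := N\<rparr>"
  let ?X = "power_topology ?TN (n + 1)"
  let ?I = "invariant_cochains ?GN ?TN \<rho>"
  have b_cocycle: "restrict b (topspace ?X) \<in> cocycles ?GN ?TN \<rho> n"
    using cocycles_operator[OF b N bounded_linear_ident] by (simp add: comp_def)
  have E_cocycle: "restrict (E \<circ> b) (topspace ?X) \<in> cocycles ?GN ?TN \<rho> n"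
    using E_comm by (intro cocycles_operator[OF b N bounded_linear_E])
  have linN: "bounded_linear (\<rho> g)" if "g \<in> N" for g using lin that subN by blast

  define diff where "diff A = (\<lambda>x\<in>topspace ?X. A (b x) - b x)" for A
  have diff: "diff A \<in> ?I (n + 1)"
    if A: "restrict (A \<circ> b) (topspace ?X) \<in> cocycles ?GN ?TN \<rho> n" for A
  proof -
    have "restrict (A \<circ> b) (topspace ?X) \<in> ?I (n + 1)" "restrict b (topspace ?X) \<in> ?I (n + 1)"
      using A b_cocycle by (simp_all add: cocycles_def)
    from invariant_cochains_lincomb[OF this N linN, of 1 "- 1"]
    show ?thesis by (simp add: diff_def restrict_def cong: if_cong)
  qed

  \<comment> \<open>\<open>D\<close> is built for \<open>E_approx_compact\<close>: the norm bound
    gives uniformity on compact sets, commutation with \<open>N\<close> keeps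
    \<open>A \<circ> b\<close> a cocycle, and the primitive \<open>h\<close> makes the difference
    from \<open>b\<close> an actual coboundary. No bound on \<open>h\<close> is imposed.\<close>
  define D where "D = {A. bounded_linear A \<and> (\<forall>v. norm (A v) \<le> M * norm v) \<and>
    (\<forall>y\<in>N. \<forall>v. A (\<rho> y v) = \<rho> y (A v)) \<and>
    (\<exists>h\<in>?I n. \<forall>x\<in>topspace ?X. coboundary ?TN n h x = A (b x) - b x)}"
  have \<rho>_D: "\<rho> c \<in> D" if c: "c \<in> C" for c
  proof -
    have c': "c \<in> carrier G" using c subC by blast
    have "\<exists>h\<in>?I n. \<forall>x\<in>topspace ?X. coboundary ?TN n h x = \<rho> c (b x) - b x"
      using assms(4) c linN by (intro translate_minus_id_coboundary[OF b N c']) auto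
    moreover have "\<forall>y\<in>N. \<forall>v. \<rho> c (\<rho> y v) = \<rho> y (\<rho> c v)" using comm[OF _ c] by simp
    ultimately show ?thesis unfolding D_def using lin[OF c'] M(2)[OF c'] by blast
  qed
  have D_convex: "(\<lambda>v. s *\<^sub>R A v + t *\<^sub>R B v) \<in> D"
    if A: "A \<in> D" and B: "B \<in> D" and st: "0 \<le> s" "0 \<le> t" "s + t = 1" for A B s t
  proof -
    have bl: "bounded_linear A" "bounded_linear B"
      and bd: "\<And>v. norm (A v) \<le> M * norm v" "\<And>v. norm (B v) \<le> M * norm v"
      and cm: "\<And>y v. y \<in> N \<Longrightarrow> A (\<rho> y v) = \<rho> y (A v)" "\<And>y v. y \<in> N \<Longrightarrow> B (\<rho> y v) = \<rho> y (B v)"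
      using A B by (auto simp: D_def)
    obtain h h' where h: "h \<in> ?I n" "\<And>x. x \<in> topspace ?X \<Longrightarrow> coboundary ?TN n h x = A (b x) - b x"
      and h': "h' \<in> ?I n" "\<And>x. x \<in> topspace ?X \<Longrightarrow> coboundary ?TN n h' x = B (b x) - b x"
      using A B unfolding D_def by blast
    define h'' where "h'' = (\<lambda>x\<in>topspace (power_topology ?TN n). s *\<^sub>R h x + t *\<^sub>R h' x)"
    have "h'' \<in> ?I n"
      unfolding h''_def using h(1) h'(1) N linN by (rule invariant_cochains_lincomb)
    moreover have "coboundary ?TN n h'' x = s *\<^sub>R A (b x) + t *\<^sub>R B (b x) - b x"
      if x: "x \<in> topspace ?X" for x
    proof -
      have om: "omit n i x \<in> topspace (power_topology ?TN n)" for i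
        using x unfolding topspace_power[OF subN] by (rule omit_in_PiE)
      have "coboundary ?TN n h'' x = s *\<^sub>R coboundary ?TN n h x + t *\<^sub>R coboundary ?TN n h' x"
        unfolding coboundary_def restrict_apply'[OF x] h''_def restrict_apply'[OF om]
          scaleR_sum_right sum.distrib[symmetric]
        by (intro sum.cong refl) (simp add: scaleR_add_right mult.commute)
      \<comment> \<open>Since the weights sum to one, the two copies of \<open>b\<close> recombine
        to exactly one.\<close>
      also have "\<dots> = s *\<^sub>R A (b x) + t *\<^sub>R B (b x) - (s + t) *\<^sub>R b x"
        unfolding h(2)[OF x] h'(2)[OF x] by (simp add: algebra_simps)
      finally show ?thesis using st(3) by simp
    qed
    moreover have "bounded_linear (\<lambda>v. s *\<^sub>R A v + t *\<^sub>R B v)"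
      using bl by (intro bounded_linear_add bounded_linear_compose[OF bounded_linear_scaleR_right])
    moreover have "norm (s *\<^sub>R A v + t *\<^sub>R B v) \<le> M * norm v" for v
    proof -
      have "norm (s *\<^sub>R A v + t *\<^sub>R B v) \<le> s * norm (A v) + t * norm (B v)"
        using norm_triangle_ineq[of "s *\<^sub>R A v" "t *\<^sub>R B v"] st by simp
      also have "\<dots> \<le> s * (M * norm v) + t * (M * norm v)"
        using bd st by (intro add_mono mult_left_mono)
      also have "\<dots> = (s + t) * (M * norm v)" by (simp only: distrib_right)
      finally show ?thesis using st(3) by simp
    qed
    moreover have "s *\<^sub>R A (\<rho> y v) + t *\<^sub>R B (\<rho> y v) = \<rho> y (s *\<^sub>R A v + t *\<^sub>R B v)"
      if "y \<in> N" for y v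
      using linN[OF that] cm[OF that] by (simp add: bounded_linear.linear linear_add linear_scale)
    ultimately show ?thesis unfolding D_def by blast
  qed

  have "diff E \<in> subtopology (compact_open_topology ?X euclidean) (?I (n + 1))
      closure_of coboundaries ?GN ?TN \<rho> n"
    unfolding in_closure_of
  proof (intro conjI allI impI)
    have cm: "?I (n + 1) \<subseteq> continuous_maps ?X euclidean"
      by (auto simp: invariant_cochains_def cochains_def)
    \<comment> \<open>The empty compact set with target \<open>UNIV\<close> yields the whole space
      of continuous maps as a subbasic set.\<close>
    have "openin (compact_open_topology ?X euclidean) (continuous_maps ?X euclidean)"
      unfolding compact_open_topology_def
      by (rule topology_generated_by_Basis, rule CollectI, rule exI[of _ "{}"], rule exI[of _ UNIV])
        (simp add: compactin_empty)
    then have "continuous_maps ?X euclidean \<subseteq> topspace (compact_open_topology ?X euclidean)"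
      by (rule openin_subset)
    then show "diff E \<in> topspace (subtopology (compact_open_topology ?X euclidean) (?I (n + 1)))"
      using diff[OF E_cocycle] cm by auto
    fix W
    assume W: "diff E \<in> W \<and> openin (subtopology (compact_open_topology ?X euclidean) (?I (n + 1))) W"
    then obtain W' where W': "openin (compact_open_topology ?X euclidean) W'" "W = W' \<inter> ?I (n + 1)"
      by (auto simp: openin_subtopology)
    then have "diff E \<in> W'" using W by blast
    then obtain K e where K: "compactin ?X K" and "0 < e"
      and nbhd: "{f \<in> continuous_maps ?X euclidean. \<forall>x\<in>K. dist (f x) (diff E x) < e} \<subseteq> W'"
      by (rule compact_open_neighbourhood[OF W'(1)])
    have "continuous_map ?X euclidean (restrict b (topspace ?X))"
      using b_cocycle
      unfolding cocycles_def invariant_cochains_def cochains_def continuous_maps_def by blast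
    from image_compactin[OF K this] have "compact (restrict b (topspace ?X) ` K)" by simp
    moreover have KX: "K \<subseteq> topspace ?X" using K by (rule compactin_subset_topspace)
    then have "restrict b (topspace ?X) ` K = b ` K"
      by (intro image_cong refl) (auto simp only: restrict_apply')
    ultimately have "compact (b ` K)" by simp
    then have "\<exists>A\<in>D. \<forall>v\<in>b ` K. norm (A v - E v) < e"
      using \<open>0 < e\<close> \<rho>_D D_convex by (intro E_approx_compact) (auto simp: D_def)
    then obtain A where A: "A \<in> D" "\<And>x. x \<in> K \<Longrightarrow> norm (A (b x) - E (b x)) < e" by blast
    obtain h where h: "h \<in> ?I n" "\<And>x. x \<in> topspace ?X \<Longrightarrow> coboundary ?TN n h x = A (b x) - b x"
      using A(1) unfolding D_def by blast
    \<comment> \<open>Both sides are restricted to the domain, so they agree as functions, off the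
      domain as well.\<close>
    have "coboundary ?TN n h = diff A"
    proof
      show "coboundary ?TN n h x = diff A x" for x
        using h(2)[of x] by (cases "x \<in> topspace ?X")
          (simp_all add: diff_def coboundary_def del: topspace_product_topology)
    qed
    then have "diff A \<in> coboundaries ?GN ?TN \<rho> n"
      using h(1) by (force simp: coboundaries_def)
    moreover have A_inv: "diff A \<in> ?I (n + 1)"
      using A(1) by (intro diff cocycles_operator[OF b N]) (auto simp: D_def)
    moreover have "dist (diff A x) (diff E x) < e" if "x \<in> K" for x
    proof -
      have "x \<in> topspace ?X" using that KX by blast
      then show ?thesis
        using A(2)[OF that] by (simp add: diff_def dist_norm del: topspace_product_topology)
    qed
    then have "diff A \<in> W'" using nbhd A_inv cm by blast
    ultimately show "\<exists>y. y \<in> coboundaries ?GN ?TN \<rho> n \<and> y \<in> W" unfolding W'(2) by blast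
  qed
  moreover have "diff E = (\<lambda>x\<in>topspace ?X. restrict (E \<circ> b) (topspace ?X) x - restrict b (topspace ?X) x)"
    unfolding diff_def by (intro restrict_ext) (simp only: restrict_apply' comp_apply)
  ultimately show ?thesis
    using E_cocycle b_cocycle by (simp only: almost_cohomologous_def simp_thms)
qed

end
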